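(* Let $K\ge1$ be an integer, $0<\theta_0<\theta^*(K)=\arctan\frac1{K(K-1)}$ (with $\theta^*(1)=\pi/2$), and $\alpha=\frac{1}{2K\tan\theta_0}$. There exist a finite index set $\mathcal Q$, a family of finite partitions $\mathcal P_{s}=\{I^{s}_i: i\in\mathcal Q\}$ of $\mathbb T^1\times\mathcal C_K^*$ into intervals, indexed by $s\in[0,1)$, and a family $\{(\gamma_i,\epsilon_i,\xi_i): i\in\mathcal Q\}$ of elements of $\mathbb T^1\times\{0,1\}\times\mathcal C_K^*$, such that the map $\varphi:\mathbb T^2\times\mathcal C_K^*\to\mathbb T^2\times\mathcal C_K^*$ defined, for every $i\in\mathcal Q$, every $s\in[0,1)$ and every $(x,\xi)\in I_i^{s}$, by $$\varphi(x,s,\xi)=(x+2s+\gamma_i,\ s+\epsilon_i\alpha,\ \xi_i)$$ (first two coordinates modulo $1$) satisfies, for every $h\ge0$ and every $(x,\eta,\theta)\in B^*_{h,\theta_0}$ with $\eta$ balanced, $$\varphi\circ\Psi(x,\eta,\theta)=\Psi\circ\phi_h(x,\eta,\theta).$$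
   Context: Fix an integer $K\ge1$. For $h\ge0$ let $\Delta_h=\{x\in\mathbb R^2: 0\le x_1\le K,\ x_2\ge -h\}$. Let $\mathcal Z_K=\{0,\dots,K-1\}\times\mathbb Z_{\ge0}$; the brick at $z\in\mathcal Z_K$ is $\square_z=[z_1,z_1+1]\times[z_2,z_2+1]$. A configuration is $\eta\in\{0,1\}^{\mathcal Z_K}$; the brick $\square_z$ is present iff $\eta(z)=1$. It is well-filled if $\eta(z)=0$ for only finitely many $z$. Let $\Delta_h^\eta$ be the closure of $\Delta_h$ minus the union of the present bricks. A state is a triple $(x,\eta,\theta)$ with $\eta$ well-filled, $x\in\Delta_h^\eta$, $\theta\in\mathbb R/2\pi\mathbb Z$; its velocity is $v(\theta)=(\cos\theta,\sin\theta)$. It is admissible if $x+s\,v(\theta)\in\operatorname{int}(\Delta_h^\eta)$ for all sufficiently small $s>0$. Semi-flow $\Phi^h_t$: the point moves in a straight line with unit velocity in $\Delta_h^\eta$. When (at a positive time) it hits the boundary of $\Delta_h^\eta$ at a point which is neither a vertex of $\Delta_h$ nor a vertex of a present brick, its velocity is reflected specularly; if the point hit belongs to a present brick, that brick is moreover removed from the configuration at that instant; otherwise the configuration is unchanged. The motion then continues in the new domain. An admissible state is regular if its trajectory never reaches, at a positive time, a vertex of $\Delta_h$ or of a brick present just before that time. $B^*_{h,\theta_0}$ is the set of regular admissible states with $x_2=-h$ and $\theta\in\{\theta_0,\pi-\theta_0\}$. The first return map is $\phi_h(x,\eta,\theta)=\Phi^h_T(x,\eta,\theta)$ with $T=\inf\{t>0:\Phi^h_t(x,\eta,\theta)\in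 B^*_{h,\theta_0}\}$, which is finite when $0<\theta_0<\theta^*(K)$. For well-filled $\eta$: $H(\eta)=\min\{z_2:\eta(z_1,z_2)=1\}$, $H^+(\eta)=1+\max\{z_2:\eta(z_1,z_2)=0\}$ ($H^+=0$ if no brick is missing); $\eta$ is balanced if $H^+(\eta)-H(\eta)\le1$. (For $0<\theta_0<\theta^*(K)$ balancedness is preserved by the dynamics.) $\mathbb T^1=\mathbb R/\mathbb Z$, $\mathbb T^2=\mathbb T^1\times\mathbb T^1$, $\mathcal C_K^*=\{0,1\}^K\setminus\{(0,\dots,0)\}$. An interval of $\mathbb T^1\times\mathcal C^*_K$ is a (possibly empty) set $I\times\{\xi\}$ with $I$ an arc of $\mathbb T^1$. The map $\Psi$ sends $(x,\eta,\theta)$ (in $B^*_{h,\theta_0}$) to $(\bar x,\bar h,\xi)\in\mathbb T^2\times\mathcal C_K^*$, where $\bar x=x_1/2K$ if $\theta=\theta_0$ and $\bar x=1-x_1/2K$ if $\theta=\pi-\theta_0$ (mod 1); $\bar h=(H(\eta)+h)/(2K\tan\theta_0)$ mod $1$; $\xi=(\eta(k,H(\eta)))_{k=0,\dots,K-1}$. *)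

theory Defs
  imports "HOL-Analysis.Analysis" "HOL-Library.FuncSet" "HOL-Library.Real_Mod"
begin

section \<open>Bricks, configurations and domains\<close>

definition Delta :: "nat \<Rightarrow> real \<Rightarrow> (real \<times> real) set" where
  "Delta K h = {x. 0 \<le> fst x \<and> fst x \<le> real K \<and> - h \<le> snd x}"

definition sites :: "nat \<Rightarrow> (nat \<times> nat) set" where
  "sites K = {..<K} \<times> UNIV"

definition brick :: "nat \<times> nat \<Rightarrow> (real \<times> real) set" where
  "brick z = {real (fst z)..real (fst z) + 1} \<times> {real (snd z)..real (snd z) + 1}"

definition Delta_vertices :: "nat \<Rightarrow> real \<Rightarrow> (real \<times> real) set" where
  "Delta_vertices K h = {(0, - h), (real K, - h)}"

definition brick_vertices :: "nat \<times> nat \<Rightarrow> (real \<times> real) set" where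
  "brick_vertices z =
     {real (fst z), real (fst z) + 1} \<times> {real (snd z), real (snd z) + 1}"

text \<open>Elements of \<open>{0,1}\<close> to the power \<open>sites K\<close> are extensional functions, so that two
  configurations are equal as soon as they agree on \<open>sites K\<close>.\<close>

type_synonym config = "nat \<times> nat \<Rightarrow> nat"

definition configs :: "nat \<Rightarrow> config set" where
  "configs K = (sites K \<rightarrow>\<^sub>E {0, 1})"

definition present :: "nat \<Rightarrow> config \<Rightarrow> (nat \<times> nat) set" where
  "present K \<eta> = {z \<in> sites K. \<eta> z = 1}"

definition missing :: "nat \<Rightarrow> config \<Rightarrow> (nat \<times> nat) set" where
  "missing K \<eta> = {z \<in> sites K. \<eta> z = 0}"

definition well_filled :: "nat \<Rightarrow> config \<Rightarrow> bool" where
  "well_filled K \<eta> \<longleftrightarrow> \<eta> \<in> configs K \<and> finite (missing K \<eta>)"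

definition domain :: "nat \<Rightarrow> real \<Rightarrow> config \<Rightarrow> (real \<times> real) set" where
  "domain K h \<eta> = closure (Delta K h - (\<Union>z\<in>present K \<eta>. brick z))"

definition vertices :: "nat \<Rightarrow> real \<Rightarrow> config \<Rightarrow> (real \<times> real) set" where
  "vertices K h \<eta> = Delta_vertices K h \<union> (\<Union>z\<in>present K \<eta>. brick_vertices z)"

section \<open>States and semi-flow\<close>

text \<open>Angles in \<open>\<real>/2\<pi>\<int>\<close> are represented by their representatives in \<open>{0..<2*pi}\<close>.\<close>

type_synonym state = "(real \<times> real) \<times> config \<times> real"

definition velocity :: "real \<Rightarrow> real \<times> real" where
  "velocity \<theta> = (cos \<theta>, sin \<theta>)"

definition states :: "nat \<Rightarrow> real \<Rightarrow> state set" where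
  "states K h = {(x, \<eta>, \<theta>). well_filled K \<eta> \<and> x \<in> domain K h \<eta> \<and> \<theta> \<in> {0..<2 * pi}}"

definition admissible :: "nat \<Rightarrow> real \<Rightarrow> state \<Rightarrow> bool" where
  "admissible K h = (\<lambda>(x, \<eta>, \<theta>). (x, \<eta>, \<theta>) \<in> states K h \<and>
     (\<forall>\<^sub>F s in at_right 0. x + s *\<^sub>R velocity \<theta> \<in> interior (domain K h \<eta>)))"

fun advance :: "real \<Rightarrow> state \<Rightarrow> state" where
  "advance s (x, \<eta>, \<theta>) = (x + s *\<^sub>R velocity \<theta>, \<eta>, \<theta>)"

text \<open>For an admissible state the infimum is positive and attained: the state enters the interior
  at once, the frontier is closed, and well-filled configurations have bounded domains.\<close>

fun hit_time :: "nat \<Rightarrow> real \<Rightarrow> state \<Rightarrow> real" where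
  "hit_time K h (x, \<eta>, \<theta>) =
     Inf {s. 0 < s \<and> x + s *\<^sub>R velocity \<theta> \<in> frontier (domain K h \<eta>)}"

definition on_vertical_side :: "nat \<Rightarrow> real \<Rightarrow> config \<Rightarrow> real \<times> real \<Rightarrow> bool" where
  "on_vertical_side K h \<eta> p \<longleftrightarrow>
     (\<exists>e>0. \<forall>s. \<bar>s\<bar> < e \<longrightarrow> p + (0, s) \<in> frontier (domain K h \<eta>))"

text \<open>Near a frontier point that is not in \<open>vertices K h \<eta>\<close>, the frontier is either a vertical
  or a horizontal segment.\<close>

definition reflect :: "nat \<Rightarrow> real \<Rightarrow> config \<Rightarrow> real \<times> real \<Rightarrow> real \<Rightarrow> real" where
  "reflect K h \<eta> p \<theta> =
     (if on_vertical_side K h \<eta> p then (pi - \<theta>) rmod (2 * pi) else (- \<theta>) rmod (2 * pi))"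

definition remove_hit :: "nat \<Rightarrow> real \<times> real \<Rightarrow> config \<Rightarrow> config" where
  "remove_hit K p \<eta> = (\<lambda>z\<in>sites K. if p \<in> brick z then 0 else \<eta> z)"

text \<open>The state right after the next hit. It is meaningful only if the point hit is not in
  \<open>vertices K h \<eta>\<close>; such a point belongs to at most one present brick.\<close>

definition collide :: "nat \<Rightarrow> real \<Rightarrow> state \<Rightarrow> state" where
  "collide K h st =
     (case advance (hit_time K h st) st of
        (p, \<eta>, \<theta>) \<Rightarrow> (p, remove_hit K p \<eta>, reflect K h \<eta> p \<theta>))"

definition collision_state :: "nat \<Rightarrow> real \<Rightarrow> state \<Rightarrow> nat \<Rightarrow> state" where
  "collision_state K h st n = (collide K h ^^ n) st"

definition collision_time :: "nat \<Rightarrow> real \<Rightarrow> state \<Rightarrow> nat \<Rightarrow> real" where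
  "collision_time K h st n = (\<Sum>m<n. hit_time K h (collision_state K h st m))"

text \<open>The semi-flow is right-continuous: at a hitting time the velocity is already reflected and
  the brick already removed.\<close>

definition flow :: "nat \<Rightarrow> real \<Rightarrow> real \<Rightarrow> state \<Rightarrow> state" where
  "flow K h t st =
     (let n = (LEAST n. t < collision_time K h st (Suc n))
      in advance (t - collision_time K h st n) (collision_state K h st n))"

text \<open>During the \<open>n\<close>-th leg, end point included, the bricks present just before
  the current time are those of the \<open>n\<close>-th collision state.\<close>

definition regular :: "nat \<Rightarrow> real \<Rightarrow> state \<Rightarrow> bool" where
  "regular K h st \<longleftrightarrow> admissible K h st \<and>
     (\<forall>n. \<forall>s\<in>{0<..hit_time K h (collision_state K h st n)}.
        case advance s (collision_state K h st n) of (p, \<eta>, \<theta>) \<Rightarrow> p \<notin> vertices K h \<eta>)"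

section \<open>The first return map\<close>

definition Bstar :: "nat \<Rightarrow> real \<Rightarrow> real \<Rightarrow> state set" where
  "Bstar K h \<theta>\<^sub>0 =
     {(x, \<eta>, \<theta>). regular K h (x, \<eta>, \<theta>) \<and> snd x = - h \<and> \<theta> \<in> {\<theta>\<^sub>0, pi - \<theta>\<^sub>0}}"

definition return_time :: "nat \<Rightarrow> real \<Rightarrow> real \<Rightarrow> state \<Rightarrow> real" where
  "return_time K h \<theta>\<^sub>0 st = Inf {t. 0 < t \<and> flow K h t st \<in> Bstar K h \<theta>\<^sub>0}"

definition first_return :: "nat \<Rightarrow> real \<Rightarrow> real \<Rightarrow> state \<Rightarrow> state" where
  "first_return K h \<theta>\<^sub>0 st = flow K h (return_time K h \<theta>\<^sub>0 st) st"

definition theta_star :: "nat \<Rightarrow> real" where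
  "theta_star K = (if K = 1 then pi / 2 else arctan (1 / (real K * (real K - 1))))"

section \<open>Balanced configurations and the factor space\<close>

definition H :: "nat \<Rightarrow> config \<Rightarrow> nat" where
  "H K \<eta> = (LEAST j. j \<in> snd ` present K \<eta>)"

definition H_plus :: "nat \<Rightarrow> config \<Rightarrow> nat" where
  "H_plus K \<eta> = (if missing K \<eta> = {} then 0 else 1 + Max (snd ` missing K \<eta>))"

definition balanced :: "nat \<Rightarrow> config \<Rightarrow> bool" where
  "balanced K \<eta> \<longleftrightarrow> int (H_plus K \<eta>) - int (H K \<eta>) \<le> 1"

text \<open>\<open>\<real>/\<int>\<close> is represented by \<open>{0..<1}\<close>, with \<open>frac\<close> as the projection.\<close>

definition T1 :: "real set" where
  "T1 = {0..<1}"

definition Cstar :: "nat \<Rightarrow> (nat \<Rightarrow> nat) set" where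
  "Cstar K = ({..<K} \<rightarrow>\<^sub>E {0, 1}) - {\<lambda>k\<in>{..<K}. 0}"

definition arc :: "real set \<Rightarrow> bool" where
  "arc I \<longleftrightarrow> (\<exists>J::real set. is_interval J \<and> I = frac ` J)"

definition interval_TC :: "nat \<Rightarrow> (real \<times> (nat \<Rightarrow> nat)) set \<Rightarrow> bool" where
  "interval_TC K S \<longleftrightarrow> (\<exists>I \<xi>. arc I \<and> \<xi> \<in> Cstar K \<and> S = I \<times> {\<xi>})"

text \<open>The members of an indexed partition may be empty.\<close>

definition interval_partition ::
    "nat \<Rightarrow> 'i set \<Rightarrow> ('i \<Rightarrow> (real \<times> (nat \<Rightarrow> nat)) set) \<Rightarrow> bool" where
  "interval_partition K Q I \<longleftrightarrow> (\<forall>i\<in>Q. interval_TC K (I i)) \<and> disjoint_family_on I Q \<and>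
     (\<Union>i\<in>Q. I i) = T1 \<times> Cstar K"

fun Psi :: "nat \<Rightarrow> real \<Rightarrow> real \<Rightarrow> state \<Rightarrow> real \<times> real \<times> (nat \<Rightarrow> nat)" where
  "Psi K h \<theta>\<^sub>0 (x, \<eta>, \<theta>) =
     (frac (if \<theta> = \<theta>\<^sub>0 then fst x / (2 * real K) else 1 - fst x / (2 * real K)),
      frac ((real (H K \<eta>) + h) / (2 * real K * tan \<theta>\<^sub>0)),
      \<lambda>k\<in>{..<K}. \<eta> (k, H K \<eta>))"

end

theory Submission
  imports Defs
begin

text \<open>
Reflecting the strip \<open>[0, K]\<close> in its two sides unfolds the horizontal motion: a particle at
\<open>x\<close> moving right is placed at \<open>X = x\<close>, moving left at \<open>X = - x\<close>, modulo \<open>2 K\<close>, and side walls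
disappear, so that \<open>X\<close> grows at constant rate. The first coordinate of \<open>Psi\<close> is \<open>X / 2 K\<close>.
In a balanced configuration, if \<open>L\<close> is the lowest level with a brick, everything above \<open>L\<close> is present. Climbing from the floor to level \<open>L\<close> advances \<open>X / 2 K\<close> by exactly
the second coordinate \<open>s\<close> of \<open>Psi\<close>, so \<open>U = 2 K frac (x + s)\<close> is where the particle meets the row.
There are two cases.

If the unit cell containing \<open>U\<close> holds a brick, the particle removes it and comes straight back
down. The total advance is \<open>2 s\<close>, the row loses one brick, and the level rises only if that was
the last one.

Otherwise the particle enters a gap of the row. A collision with the side of a brick removes the
brick and reverses the direction, which in the unfolded coordinate is a jump \<open>X \<mapsto> - X\<close> at an
integer. Hence the particle performs a deterministic walk on unit cells, driven only by the set of
remaining bricks and the current unfolded cell. When \<open>z\<close> cells of the row are empty, the walk meets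
the next brick after at most \<open>2 z\<close> cells, because each empty cell is crossed at most once in each
direction; so after \<open>2 (1 + \<dots> + (K - 1)) = K (K - 1)\<close> cells the row is empty
(\<open>walk_clears_row\<close>). The hypothesis on \<open>\<theta>\<^sub>0\<close> says exactly that
a particle needs a larger horizontal distance than this to climb one level. The row is
therefore cleared before level \<open>L + 1\<close> is reached, where the particle meets a full row, removes one
brick of it and comes down. Its total advance is \<open>2 s\<close> plus a constant that depends only on the
walk, and which brick it removes depends on the walk and on one further carry bit.

The pieces of the partition are thus indexed by the set of bricks in the row, the unfolded cell of
\<open>U\<close> and the carry bit; in each fibre they are arcs. Vertices never interfere, because regular
trajectories avoid them.

The reduction of the semi-flow to this picture is \<open>returns_from_floor\<close>; \<open>first_return_eq\<close> turns it into a
statement about the first return map, and \<open>Psi_first_return\<close> reads it in the factor space.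
\<close>

section \<open>The unfolded strip\<close>

text \<open>An integer \<open>c\<close> stands for the unit interval \<open>[c, c + 1]\<close> of the unfolded line, which has period
\<open>2 K\<close>. The first half of a period is the strip crossed from left to right, the second half is the strip
crossed from right to left.\<close>

definition rightward :: "nat \<Rightarrow> int \<Rightarrow> bool" where
  "rightward K c \<longleftrightarrow> c mod (2 * int K) < int K"

definition cell :: "nat \<Rightarrow> int \<Rightarrow> nat" where
  "cell K c = nat (if rightward K c then c mod (2 * int K) else 2 * int K - 1 - c mod (2 * int K))"

lemma mod_2K_bounds: "1 \<le> K \<Longrightarrow> 0 \<le> c mod (2 * int K) \<and> c mod (2 * int K) < 2 * int K"
  by simp

lemma int_cell:
  assumes "1 \<le> K"
  shows "int (cell K c) = (if rightward K c then c mod (2 * int K) else 2 * int K - 1 - c mod (2 * int K))"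
  using mod_2K_bounds[OF assms, of c] by (auto simp: cell_def)

lemma cell_less: "1 \<le> K \<Longrightarrow> cell K c < K"
  using mod_2K_bounds[of K c] by (auto simp: cell_def rightward_def)

lemma rightward_add_period [simp]: "rightward K (c + 2 * int K * q) = rightward K c"
  by (simp add: rightward_def)

lemma cell_add_period [simp]: "cell K (c + 2 * int K * q) = cell K c"
  by (simp add: cell_def rightward_def)

lemma succ_mod_2K:
  assumes "1 \<le> K"
  shows "(c + 1) mod (2 * int K) = (if c mod (2 * int K) = 2 * int K - 1 then 0 else c mod (2 * int K) + 1)"
proof -
  have "(c + 1) mod (2 * int K) = (c mod (2 * int K) + 1) mod (2 * int K)"
    by (simp add: mod_simps)
  then show ?thesis
    using mod_2K_bounds[OF assms, of c] by (auto simp: mod_pos_pos_trivial)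
qed

lemma neg_mod_2K:
  assumes "1 \<le> K"
  shows "(- 1 - c) mod (2 * int K) = 2 * int K - 1 - c mod (2 * int K)"
proof -
  have "(- 1 - c) mod (2 * int K) = (- 1 - c mod (2 * int K)) mod (2 * int K)"
    by (simp add: mod_simps)
  also have "\<dots> = (- 1 - c mod (2 * int K) + 2 * int K) mod (2 * int K)"
    by simp
  also have "\<dots> = - 1 - c mod (2 * int K) + 2 * int K"
    using mod_2K_bounds[OF assms, of c] by (intro mod_pos_pos_trivial) auto
  finally show ?thesis by simp
qed

text \<open>Reversing the direction of motion is the reflection \<open>X \<mapsto> - X\<close> of the unfolded line; it maps
\<open>[c, c + 1]\<close> to \<open>[- 1 - c, - c]\<close>.\<close>

lemma reversed_cell:
  assumes "1 \<le> K"
  shows "cell K (- 1 - c) = cell K c" "rightward K (- 1 - c) \<longleftrightarrow> \<not> rightward K c"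
proof -
  show r: "rightward K (- 1 - c) \<longleftrightarrow> \<not> rightward K c"
    using mod_2K_bounds[OF assms, of c] by (auto simp: rightward_def neg_mod_2K[OF assms])
  have "int (cell K (- 1 - c)) = int (cell K c)"
    unfolding int_cell[OF assms] r by (simp add: neg_mod_2K[OF assms])
  then show "cell K (- 1 - c) = cell K c" by simp
qed

lemma succ_cell:
  assumes "1 \<le> K"
  obtains
    (right) "rightward K c" "rightward K (c + 1)" "cell K (c + 1) = Suc (cell K c)"
  | (right_wall) "rightward K c" "\<not> rightward K (c + 1)" "cell K (c + 1) = cell K c" "Suc (cell K c) = K"
  | (left) "\<not> rightward K c" "\<not> rightward K (c + 1)" "cell K c = Suc (cell K (c + 1))"
  | (left_wall) "\<not> rightward K c" "rightward K (c + 1)" "cell K (c + 1) = cell K c" "cell K c = 0"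
proof -
  note s = succ_mod_2K[OF assms, of c] and b = mod_2K_bounds[OF assms, of c]
  note i = int_cell[OF assms, of c] int_cell[OF assms, of "c + 1"]
  consider "rightward K c" "rightward K (c + 1)" | "rightward K c" "\<not> rightward K (c + 1)"
    | "\<not> rightward K c" "\<not> rightward K (c + 1)" | "\<not> rightward K c" "rightward K (c + 1)" by blast
  then show thesis
  proof cases
    case 1
    then show ?thesis using s b i by (intro right) (auto simp: rightward_def split: if_splits)
  next
    case 2
    then show ?thesis using s b i by (intro right_wall) (auto simp: rightward_def split: if_splits)
  next
    case 3
    then show ?thesis using s b i by (intro left) (auto simp: rightward_def split: if_splits)
  next
    case 4
    then show ?thesis using s b i by (intro left_wall) (auto simp: rightward_def split: if_splits)
  qed
qed

definition sg :: "bool \<Rightarrow> real" where "sg b = (if b then 1 else - 1)"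

lemma sg_not [simp]: "sg (\<not> b) = - sg b"
  by (simp add: sg_def)

lemma sg_simps [simp]: "sg True = 1" "sg False = - 1"
  by (simp_all add: sg_def)

text \<open>The real point of the strip above an unfolded coordinate. At an integer \<open>X\<close> the particle counts as
being at the beginning of the cell it is about to cross.\<close>

definition fold_pos :: "nat \<Rightarrow> real \<Rightarrow> real" where
  "fold_pos K X = (if rightward K \<lfloor>X\<rfloor> then real (cell K \<lfloor>X\<rfloor>) + frac X else real (cell K \<lfloor>X\<rfloor>) + 1 - frac X)"

text \<open>The formula of the definition holds up to the right end of the cell, since \<open>fold_pos\<close> is continuous.\<close>

lemma fold_pos_in_cell:
  assumes K: "1 \<le> K" and X: "of_int c \<le> X" "X \<le> of_int c + 1"
  shows "fold_pos K X = (if rightward K c then real (cell K c) + (X - of_int c) else real (cell K c) + 1 - (X - of_int c))"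
proof (cases "X = of_int c + 1")
  case False
  then have "\<lfloor>X\<rfloor> = c" using X by linarith
  then show ?thesis by (simp add: fold_pos_def frac_def)
next
  case True
  then have fl: "\<lfloor>X\<rfloor> = c + 1" "frac X = 0" by (simp_all add: frac_def)
  show ?thesis
    using K by (cases rule: succ_cell[of K c]) (auto simp: fold_pos_def fl True)
qed

lemma fold_pos_add:
  assumes K: "1 \<le> K" and X: "of_int c \<le> X" "0 \<le> d" "X + d \<le> of_int c + 1"
  shows "fold_pos K (X + d) = fold_pos K X + sg (rightward K c) * d"
  using X fold_pos_in_cell[OF K, of c X] fold_pos_in_cell[OF K, of c "X + d"] by auto

lemma fold_pos_period: "fold_pos K (X + 2 * real K * of_int q) = fold_pos K X"
proof -
  have e: "X + 2 * real K * of_int q = X + of_int (2 * int K * q)" by simp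
  have "\<lfloor>X + 2 * real K * of_int q\<rfloor> = \<lfloor>X\<rfloor> + 2 * int K * q"
    unfolding e by (rule floor_add_int[symmetric])
  moreover have "frac (X + 2 * real K * of_int q) = frac X"
    unfolding e by (simp add: frac_def)
  ultimately show ?thesis by (simp add: fold_pos_def)
qed

lemma fold_pos_boundary:
  assumes K: "1 \<le> K" and k: "k < K"
  shows "real k \<le> fold_pos K (of_int c + 1) \<and> fold_pos K (of_int c + 1) \<le> real k + 1 \<longleftrightarrow>
    k = cell K c \<or> k = cell K (c + 1)"
proof -
  have "fold_pos K (of_int c + 1) = (if rightward K c then real (cell K c) + 1 else real (cell K c))"
    using fold_pos_in_cell[OF K, of c "of_int c + 1"] by simp
  then show ?thesis
    using k cell_less[OF K, of c]
    by (cases rule: succ_cell[OF K, of c]) auto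
qed

lemma fold_pos_interior:
  assumes K: "1 \<le> K" and X: "of_int c < X" "X < of_int c + 1"
  shows "real (cell K c) < fold_pos K X" "fold_pos K X < real (cell K c) + 1"
  using fold_pos_in_cell[OF K, of c X] X by auto

lemma fold_pos_between:
  assumes "1 \<le> K" "of_int c \<le> X" "X \<le> of_int c + 1"
  shows "real (cell K c) \<le> fold_pos K X" "fold_pos K X \<le> real (cell K c) + 1"
  using fold_pos_in_cell[OF assms] assms(2,3) by auto

lemma fold_pos_bounds:
  assumes K: "1 \<le> K"
  shows "0 \<le> fold_pos K X" "fold_pos K X \<le> real K"
proof -
  have "real (cell K \<lfloor>X\<rfloor>) + 1 \<le> real K" using cell_less[OF K, of "\<lfloor>X\<rfloor>"] by linarith
  moreover have "fold_pos K X = real (cell K \<lfloor>X\<rfloor>) + frac X \<or> fold_pos K X = real (cell K \<lfloor>X\<rfloor>) + 1 - frac X"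
    by (simp add: fold_pos_def)
  ultimately show "0 \<le> fold_pos K X" "fold_pos K X \<le> real K"
    using frac_ge_0[of X] frac_lt_1[of X] of_nat_0_le_iff[of "cell K \<lfloor>X\<rfloor>", where ?'a = real] by linarith+
qed

lemma fold_pos_at_wall:
  assumes K: "1 \<le> K" and "rightward K c \<noteq> rightward K (c + 1)"
  shows "fold_pos K (of_int c + 1) \<in> {0, real K}"
proof -
  have "fold_pos K (of_int c + 1) = (if rightward K c then real (cell K c) + 1 else real (cell K c))"
    using fold_pos_in_cell[OF K, of c "of_int c + 1"] by simp
  then show ?thesis
    using assms(2) by (cases rule: succ_cell[OF K, of c]) auto
qed

section \<open>The walk that clears a row\<close>

text \<open>One step of the walk inside a row whose bricks are \<open>B\<close>: the particle crosses the cell \<open>c\<close>. If the cell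
ahead holds a brick, that brick is removed and the motion is reversed. A side wall needs no case of its own:
there \<open>c\<close> and \<open>c + 1\<close> are the same cell of the strip, crossed in opposite directions.\<close>

definition walk_step :: "nat \<Rightarrow> nat set \<times> int \<Rightarrow> nat set \<times> int" where
  "walk_step K = (\<lambda>(B, c). if cell K (c + 1) \<in> B then (B - {cell K (c + 1)}, - 1 - c) else (B, c + 1))"

text \<open>Until the next brick is met the walk runs through empty cells, and within one period of \<open>2 K\<close> it
crosses each of them at most twice, once per direction.\<close>

lemma next_brick:
  assumes K: "1 \<le> K" and B: "B \<subseteq> {..<K}" "B \<noteq> {}" and c: "cell K c \<notin> B"
  obtains d where "1 \<le> d" "d \<le> 2 * (K - card B)" "cell K (c + int d) \<in> B"
    "\<forall>i<d. cell K (c + int i) \<notin> B"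
proof -
  obtain k where k: "k \<in> B" "k < K" using B by auto
  \<comment> \<open>within one period, rightward motion crosses the cell \<open>k\<close>\<close>
  define d0 where "d0 = nat ((int k - c) mod (2 * int K))"
  have d0: "d0 < 2 * K" "int d0 = (int k - c) mod (2 * int K)"
    using mod_2K_bounds[OF K, of "int k - c"] by (auto simp: d0_def)
  have m: "(c + int d0) mod (2 * int K) = int k"
    using k by (simp add: d0(2) mod_simps)
  have hit: "cell K (c + int d0) \<in> B"
    using k m by (simp add: cell_def rightward_def)
  define d where "d = (LEAST d. cell K (c + int d) \<in> B)"
  have d: "cell K (c + int d) \<in> B" unfolding d_def using hit by (rule LeastI)
  have dle: "d \<le> d0" unfolding d_def using hit by (rule Least_le)
  have clear: "cell K (c + int i) \<notin> B" if "i < d" for i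
    using not_less_Least that unfolding d_def by blast
  have d1: "1 \<le> d" using c d by (cases d) auto
  let ?f = "\<lambda>i. (cell K (c + int i), rightward K (c + int i))"
  have inj: "inj_on ?f {..<d}"
  proof (rule inj_onI)
    fix i j assume ij: "i \<in> {..<d}" "j \<in> {..<d}" "?f i = ?f j"
    then have "(c + int i) mod (2 * int K) = (c + int j) mod (2 * int K)"
      using int_cell[OF K, of "c + int i"] int_cell[OF K, of "c + int j"] by (auto split: if_splits)
    then have "2 * int K dvd (c + int i) - (c + int j)"
      by (simp add: mod_eq_dvd_iff)
    then have dv: "2 * int K dvd int i - int j" by simp
    have "\<bar>int i - int j\<bar> < 2 * int K" using ij dle d0 by auto
    with dv show "i = j"
      using dvd_imp_le_int[of "int i - int j" "2 * int K"] by force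
  qed
  have "?f ` {..<d} \<subseteq> ({..<K} - B) \<times> UNIV"
    using clear cell_less[OF K] by auto
  then have "card (?f ` {..<d}) \<le> card (({..<K} - B) \<times> (UNIV :: bool set))"
    by (intro card_mono) auto
  then have "d \<le> card (({..<K} - B) \<times> (UNIV :: bool set))"
    by (simp add: card_image[OF inj])
  also have "\<dots> = 2 * (K - card B)"
    using B by (simp add: card_cartesian_product card_Diff_subset finite_subset)
  finally show thesis using that d1 d clear by blast
qed

lemma walk_free_cells:
  assumes "\<And>i. 0 < i \<Longrightarrow> i \<le> j \<Longrightarrow> cell K (c + int i) \<notin> B"
  shows "(walk_step K ^^ j) (B, c) = (B, c + int j)"
  using assms
proof (induction j)
  case (Suc j)
  then have "(walk_step K ^^ j) (B, c) = (B, c + int j)" by simp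
  moreover have "cell K (c + int j + 1) \<notin> B" using Suc.prems[of "Suc j"] by (simp add: algebra_simps)
  ultimately show ?case by (simp add: walk_step_def)
qed simp

text \<open>With \<open>z = K - j\<close> empty cells, the quantity \<open>z (z - 1) = 2 (1 + \<dots> + (z - 1))\<close> bounds the number of steps
that can already have been spent; removing one more brick takes at most \<open>2 z\<close> further steps and
\<open>z (z - 1) + 2 z = (z + 1) z\<close>.\<close>

lemma walk_clears_row_aux:
  assumes K: "1 \<le> K" and "B \<subseteq> {..<K}" "cell K c \<notin> B" "card B = j"
  shows "\<exists>n. n + (K - j) * (K - j - 1) \<le> K * (K - 1) \<and> fst ((walk_step K ^^ n) (B, c)) = {}"
  using assms(2-)
proof (induction j arbitrary: B c)
  case 0
  then have "B = {}" by (simp add: finite_subset)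
  then show ?case by (intro exI[of _ 0]) simp
next
  case (Suc j)
  have fin: "finite B" using Suc.prems by (simp add: finite_subset)
  have Bne: "B \<noteq> {}" using Suc.prems by auto
  obtain d where d: "1 \<le> d" "d \<le> 2 * (K - card B)" "cell K (c + int d) \<in> B"
    "\<forall>i<d. cell K (c + int i) \<notin> B"
    using next_brick[OF K Suc.prems(1) Bne Suc.prems(2)] .
  define B' where "B' = B - {cell K (c + int d)}"
  have st: "(walk_step K ^^ d) (B, c) = (B', - 1 - (c + int (d - 1)))"
  proof -
    obtain e where e: "d = Suc e" using d(1) by (cases d) auto
    have "(walk_step K ^^ e) (B, c) = (B, c + int e)"
      using d(4) e by (intro walk_free_cells) auto
    moreover have "cell K (c + int e + 1) \<in> B" using d(3) e by (simp add: algebra_simps)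
    ultimately show ?thesis by (simp add: e walk_step_def B'_def algebra_simps)
  qed
  have "cell K (- 1 - (c + int (d - 1))) \<notin> B'"
    using d(1) d(4)[rule_format, of "d - 1"] unfolding reversed_cell(1)[OF K] B'_def by simp
  moreover have "B' \<subseteq> {..<K}" "card B' = j"
    using Suc.prems fin d(3) by (auto simp: B'_def)
  ultimately obtain n where n: "n + (K - j) * (K - j - 1) \<le> K * (K - 1)"
    "fst ((walk_step K ^^ n) (B', - 1 - (c + int (d - 1)))) = {}"
    using Suc.IH by blast
  have "card B \<le> K" using Suc.prems card_mono[of "{..<K}" B] by simp
  then have jK: "Suc j \<le> K" using Suc.prems by simp
  then obtain z where z: "K = z + Suc j" by (metis add.commute le_Suc_ex)
  have "d \<le> 2 * z" using d(2) Suc.prems(3) z by simp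
  moreover have "n + (z + 1) * z \<le> K * (K - 1)" using n(1) z by simp
  moreover have "2 * z + z * (z - 1) = (z + 1) * z" by (cases z) auto
  ultimately have "n + d + (K - Suc j) * (K - Suc j - 1) \<le> K * (K - 1)"
    using z by simp
  moreover have "fst ((walk_step K ^^ (n + d)) (B, c)) = {}"
    using n(2) by (simp add: funpow_add st)
  ultimately show ?case by blast
qed

lemma walk_empty_row: "fst P = {} \<Longrightarrow> fst ((walk_step K ^^ n) P) = {}"
  by (induction n) (auto simp: walk_step_def split: prod.splits)

lemma walk_clears_row:
  assumes K: "1 \<le> K" and "B \<subseteq> {..<K}" "cell K c \<notin> B"
  shows "fst ((walk_step K ^^ (K * (K - 1))) (B, c)) = {}"
proof -
  obtain n where n: "n \<le> K * (K - 1)" "fst ((walk_step K ^^ n) (B, c)) = {}"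
    using walk_clears_row_aux[OF assms refl] by (meson add_leE)
  have "(walk_step K ^^ (K * (K - 1))) (B, c) = (walk_step K ^^ (K * (K - 1) - n)) ((walk_step K ^^ n) (B, c))"
    using n(1) funpow_add[of "K * (K - 1) - n" n "walk_step K"] by simp
  then show ?thesis using walk_empty_row n(2) by metis
qed

lemma walk_stays_in_gap:
  assumes K: "1 \<le> K" and "B \<subseteq> {..<K}" "cell K c \<notin> B"
    and "(walk_step K ^^ n) (B, c) = (B', c')"
  shows "B' \<subseteq> {..<K} \<and> cell K c' \<notin> B'"
  using assms(4)
proof (induction n arbitrary: B' c')
  case 0
  then show ?case using assms by simp
next
  case (Suc n)
  obtain B1 c1 where 1: "(walk_step K ^^ n) (B, c) = (B1, c1)" by fastforce
  then have "B1 \<subseteq> {..<K} \<and> cell K c1 \<notin> B1" by (rule Suc.IH)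
  with 1 Suc.prems show ?case
    by (auto simp: walk_step_def reversed_cell[OF K] split: if_splits)
qed

text \<open>The state of the walk after a number of steps that suffices to clear any row; it is the same number for
all rows, so that the remaining flight to the next level has a fixed duration.\<close>

definition passage :: "nat \<Rightarrow> nat set \<Rightarrow> int \<Rightarrow> nat set \<times> int" where
  "passage K B c = (walk_step K ^^ (K * (K - 1))) (B, c)"

section \<open>Balanced configurations and their domains\<close>

text \<open>The balanced configurations: rows below \<open>L\<close> are missing, rows above are present, and \<open>B\<close> is the set of
bricks present in row \<open>L\<close>. The set \<open>B\<close> may be empty; \<open>layered_empty\<close> then raises the level.\<close>

definition layered :: "nat \<Rightarrow> nat \<Rightarrow> nat set \<Rightarrow> config" where
  "layered K L B = (\<lambda>z\<in>sites K. if snd z < L then 0 else if snd z = L then of_bool (fst z \<in> B) else 1)"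

lemma present_layered:
  "present K (layered K L B) = {z. fst z < K \<and> (snd z = L \<and> fst z \<in> B \<or> L < snd z)}"
  by (auto simp: present_def layered_def sites_def)

lemma missing_layered:
  "missing K (layered K L B) = {z. fst z < K \<and> (snd z = L \<and> fst z \<notin> B \<or> snd z < L)}"
  by (auto simp: missing_def layered_def sites_def)

lemma well_filled_layered: "well_filled K (layered K L B)"
proof -
  have "missing K (layered K L B) \<subseteq> {..<K} \<times> {..L}"
    by (auto simp: missing_layered)
  then have "finite (missing K (layered K L B))"
    by (rule finite_subset) simp
  then show ?thesis
    by (auto simp: well_filled_def configs_def layered_def)
qed

lemma layered_empty: "layered K L {} = layered K (Suc L) {..<K}"
  by (auto simp: layered_def sites_def fun_eq_iff restrict_def)

lemma H_layered:
  assumes "B \<subseteq> {..<K}" "B \<noteq> {}"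
  shows "H K (layered K L B) = L"
  unfolding H_def
proof (rule Least_equality)
  obtain k where "k \<in> B" using assms by blast
  then have "(k, L) \<in> present K (layered K L B)" using assms by (auto simp: present_layered)
  then show "L \<in> snd ` present K (layered K L B)" by force
qed (auto simp: present_layered)

lemma balanced_imp_layered:
  assumes K: "1 \<le> K" and wf: "well_filled K \<eta>" and bal: "balanced K \<eta>"
  obtains B where "B \<subseteq> {..<K}" "B \<noteq> {}" "\<eta> = layered K (H K \<eta>) B"
proof -
  have conf: "\<eta> \<in> configs K" and fin: "finite (missing K \<eta>)"
    using wf by (auto simp: well_filled_def)
  have val: "\<eta> z = 0 \<or> \<eta> z = 1" if "z \<in> sites K" for z
    using conf that by (auto simp: configs_def PiE_iff)
  \<comment> \<open>the row above all missing bricks; it shows that \<open>H\<close> is the least element of a nonempty set\<close>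
  define j where "j = (if missing K \<eta> = {} then 0 else Suc (Max (snd ` missing K \<eta>)))"
  have "(0, j) \<notin> missing K \<eta>"
  proof
    assume a: "(0, j) \<in> missing K \<eta>"
    then have "j \<le> Max (snd ` missing K \<eta>)" using fin by (intro Max_ge) force+
    then show False using a by (auto simp: j_def split: if_splits)
  qed
  then have "(0, j) \<in> present K \<eta>"
    using val[of "(0, j)"] K by (auto simp: missing_def present_def sites_def)
  then have ex: "j \<in> snd ` present K \<eta>" by force
  have Hin: "H K \<eta> \<in> snd ` present K \<eta>" unfolding H_def using ex by (rule LeastI)
  have Hmin: "H K \<eta> \<le> snd z" if "z \<in> present K \<eta>" for z
    unfolding H_def using that by (intro Least_le) auto
  have miss: "snd z \<le> H K \<eta>" if z: "z \<in> missing K \<eta>" for z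
  proof -
    have "snd z \<le> Max (snd ` missing K \<eta>)" using fin z by (intro Max_ge) auto
    moreover have "H_plus K \<eta> = Suc (Max (snd ` missing K \<eta>))"
      using z by (auto simp: H_plus_def)
    ultimately show ?thesis using bal by (simp add: balanced_def)
  qed
  define B where "B = {k. k < K \<and> \<eta> (k, H K \<eta>) = 1}"
  have "\<eta> = layered K (H K \<eta>) B"
  proof
    fix z
    show "\<eta> z = layered K (H K \<eta>) B z"
    proof (cases "z \<in> sites K")
      case False
      then show ?thesis using conf by (cases z) (auto simp: layered_def configs_def PiE_iff extensional_def)
    next
      case True
      consider "snd z < H K \<eta>" | "snd z = H K \<eta>" | "snd z > H K \<eta>" by linarith
      then show ?thesis
      proof cases
        case 1
        then have "z \<notin> present K \<eta>" using Hmin[of z] by auto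
        then show ?thesis using True 1 val[OF True] by (auto simp: layered_def present_def)
      next
        case 2
        then show ?thesis using True val[OF True]
          by (cases z) (auto simp: layered_def B_def sites_def)
      next
        case 3
        then have "z \<notin> missing K \<eta>" using miss[of z] by auto
        then show ?thesis using True 3 val[OF True] by (auto simp: layered_def missing_def)
      qed
    qed
  qed
  moreover have "B \<noteq> {}" using Hin by (auto simp: B_def present_def sites_def)
  moreover have "B \<subseteq> {..<K}" by (auto simp: B_def)
  ultimately show thesis using that by blast
qed

text \<open>The interior of the domain of a layered configuration; see \<open>interior_domain_layered\<close>.\<close>

definition free_region :: "nat \<Rightarrow> real \<Rightarrow> nat \<Rightarrow> nat set \<Rightarrow> (real \<times> real) set" where
  "free_region K h L B = {(x, y). 0 < x \<and> x < real K \<and> - h < y \<and> y < real L + 1 \<and>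
     (\<forall>k\<in>B. real L \<le> y \<longrightarrow> x < real k \<or> real k + 1 < x)}"

lemma open_free_region:
  assumes "finite B"
  shows "open (free_region K h L B)"
proof -
  have "free_region K h L B =
     ({0<..<real K} \<times> {- h<..<real L + 1}) - (\<Union>k\<in>B. {real k..real k + 1} \<times> {real L..})"
    by (rule set_eqI) (auto simp: free_region_def not_le)
  moreover have "closed (\<Union>k\<in>B. {real k..real k + 1} \<times> {real L..})"
    using assms by (intro closed_UN ballI closed_Times closed_atLeastAtMost closed_atLeast)
  ultimately show ?thesis
    by (simp add: open_Diff open_Times)
qed

lemma mem_brick_iff:
  "(x, y) \<in> brick (k, j) \<longleftrightarrow> real k \<le> x \<and> x \<le> real k + 1 \<and> real j \<le> y \<and> y \<le> real j + 1"
  by (auto simp: brick_def)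

lemma domain_subset_Delta: "domain K h \<eta> \<subseteq> Delta K h"
proof -
  have "Delta K h = {0..real K} \<times> {- h..}" by (auto simp: Delta_def)
  then have "closed (Delta K h)" by (simp add: closed_Times)
  then show ?thesis unfolding domain_def by (intro closure_minimal) auto
qed

lemma interior_Delta: "interior (Delta K h) = {0<..<real K} \<times> {- h<..}"
proof -
  have "Delta K h = {0..real K} \<times> {- h..}" by (auto simp: Delta_def)
  then show ?thesis
    by (simp add: interior_Times interior_atLeastAtMost_real interior_real_atLeast)
qed

text \<open>An open set that meets a brick meets its interior, and the interior of a present brick lies outside the
domain.\<close>

lemma interior_domain_disjoint_brick:
  assumes "z \<in> present K \<eta>"
  shows "interior (domain K h \<eta>) \<inter> brick z = {}"
proof -
  have "interior (brick z) \<inter> (Delta K h - (\<Union>z\<in>present K \<eta>. brick z)) = {}"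
    using assms interior_subset by blast
  then have "interior (brick z) \<inter> domain K h \<eta> = {}"
    unfolding domain_def by (subst open_Int_closure_eq_empty) auto
  then have "interior (domain K h \<eta>) \<inter> interior (brick z) = {}"
    using interior_subset by blast
  then have "interior (domain K h \<eta>) \<inter> closure (interior (brick z)) = {}"
    by (subst open_Int_closure_eq_empty) auto
  moreover have "closure (interior (brick z)) = brick z"
    by (simp add: brick_def interior_Times closure_Times interior_atLeastAtMost_real)
  ultimately show ?thesis by simp
qed

lemma interior_domain_layered:
  assumes K: "1 \<le> K" and B: "B \<subseteq> {..<K}"
  shows "interior (domain K h (layered K L B)) = free_region K h L B"
proof
  let ?D = "domain K h (layered K L B)"
  have "free_region K h L B \<subseteq> Delta K h - (\<Union>z\<in>present K (layered K L B). brick z)"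
  proof (rule subsetI)
    fix p assume p: "p \<in> free_region K h L B"
    obtain x y where xy: "p = (x, y)" by (cases p)
    have "p \<notin> brick z" if z: "z \<in> present K (layered K L B)" for z
    proof
      assume b: "p \<in> brick z"
      obtain k j where kj: "z = (k, j)" by (cases z)
      have "j = L \<and> k \<in> B"
      proof (rule ccontr)
        assume "\<not> ?thesis"
        then have "L + 1 \<le> j" using z by (auto simp: present_layered kj)
        then have "real L + 1 \<le> real j" by linarith
        then show False using b p by (auto simp: xy kj mem_brick_iff free_region_def)
      qed
      then show False using b p by (auto simp: xy kj mem_brick_iff free_region_def)
    qed
    moreover have "p \<in> Delta K h" using p by (auto simp: free_region_def Delta_def)
    ultimately show "p \<in> Delta K h - (\<Union>z\<in>present K (layered K L B). brick z)" by blast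
  qed
  then have "free_region K h L B \<subseteq> ?D"
    unfolding domain_def using closure_subset by blast
  moreover have "open (free_region K h L B)"
    using B by (intro open_free_region) (simp add: finite_subset)
  ultimately show "free_region K h L B \<subseteq> interior ?D" by (rule interior_maximal)
  show "interior ?D \<subseteq> free_region K h L B"
  proof (rule subsetI)
    fix p assume p: "p \<in> interior ?D"
    obtain x y where xy: "p = (x, y)" by (cases p)
    have "p \<in> interior (Delta K h)"
      using p interior_mono[OF domain_subset_Delta] by blast
    then have box: "0 < x" "x < real K" "- h < y"
      by (auto simp: xy interior_Delta)
    have nb: "p \<notin> brick z" if "z \<in> present K (layered K L B)" for z
      using interior_domain_disjoint_brick[OF that] p by blast
    have "y < real L + 1"
    proof (rule ccontr)
      assume y: "\<not> ?thesis"
      define k j where "k = nat \<lfloor>x\<rfloor>" and "j = nat \<lfloor>y\<rfloor>"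
      have k: "real k = of_int \<lfloor>x\<rfloor>" "real j = of_int \<lfloor>y\<rfloor>" using box y by (simp_all add: k_def j_def)
      have "k < K" using box k by linarith
      moreover have "L < j" using y k by linarith
      ultimately have "(k, j) \<in> present K (layered K L B)" by (simp add: present_layered)
      moreover have "p \<in> brick (k, j)" unfolding xy mem_brick_iff k by linarith
      ultimately show False using nb by blast
    qed
    moreover have "x < real k \<or> real k + 1 < x" if "k \<in> B" "real L \<le> y" for k
    proof -
      have "(k, L) \<in> present K (layered K L B)" using that B by (auto simp: present_layered)
      then have "p \<notin> brick (k, L)" by (rule nb)
      then show ?thesis using that \<open>y < real L + 1\<close> by (auto simp: xy mem_brick_iff)
    qed
    ultimately show "p \<in> free_region K h L B" using box by (auto simp: free_region_def xy)
  qed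
qed

text \<open>The domain is closed, so it contains the end points of segments through its interior. Together with the
description of the interior this identifies frontier points without an explicit description of the domain.\<close>

lemma domain_if_approached:
  assumes "\<forall>\<^sub>F s in at_right 0. p + s *\<^sub>R v \<in> interior (domain K h \<eta>)"
  shows "p \<in> domain K h \<eta>"
proof -
  have "((\<lambda>s. p + s *\<^sub>R v) \<longlongrightarrow> p + 0 *\<^sub>R v) (at_right 0)"
    by (intro tendsto_intros)
  moreover have "closed (domain K h \<eta>)" by (simp add: domain_def)
  moreover have "\<forall>\<^sub>F s in at_right 0. p + s *\<^sub>R v \<in> domain K h \<eta>"
    using assms by eventually_elim (use interior_subset in blast)
  ultimately show ?thesis
    using Lim_in_closed_set[of "domain K h \<eta>" "\<lambda>s. p + s *\<^sub>R v" "at_right 0" "p + 0 *\<^sub>R v"]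
    by (simp add: trivial_limit_at_right_real)
qed

lemma frontier_domain: "p \<in> frontier (domain K h \<eta>) \<longleftrightarrow> p \<in> domain K h \<eta> \<and> p \<notin> interior (domain K h \<eta>)"
  by (simp add: frontier_def domain_def)

text \<open>Points below level \<open>L + 1\<close> touch no brick of a row above \<open>L\<close>, so only row \<open>L\<close> can change.\<close>

lemma remove_hit_layered:
  assumes "B \<subseteq> {..<K}" "snd p < real L + 1"
  shows "remove_hit K p (layered K L B) = layered K L (B - {k. p \<in> brick (k, L)})"
proof
  fix z :: "nat \<times> nat"
  obtain k j where kj: "z = (k, j)" by (cases z)
  have "p \<notin> brick (k, j)" if "L < j"
  proof -
    have "real L + 1 \<le> real j" using that by linarith
    then show ?thesis using assms(2) by (cases p) (auto simp: mem_brick_iff)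
  qed
  then show "remove_hit K p (layered K L B) z = layered K L (B - {k. p \<in> brick (k, L)}) z"
    by (auto simp: remove_hit_def layered_def kj)
qed

lemma vertices_layered_brick:
  assumes "B \<subseteq> {..<K}" "k \<in> B" "x = real k \<or> x = real k + 1"
  shows "(x, real L) \<in> vertices K h (layered K L B)"
proof -
  have "(k, L) \<in> present K (layered K L B)" using assms by (auto simp: present_layered)
  moreover have "(x, real L) \<in> brick_vertices (k, L)" using assms by (auto simp: brick_vertices_def)
  ultimately show ?thesis by (auto simp: vertices_def)
qed

section \<open>Trajectories as chains of legs\<close>

lemma advance_advance: "advance r (advance s st) = advance (s + r) st"
  by (cases st) (simp add: algebra_simps)

lemma advance_0 [simp]: "advance 0 st = st"
  by (cases st) simp

lemma collision_state_Suc: "collision_state K h st (Suc n) = collide K h (collision_state K h st n)"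
  by (simp add: collision_state_def)

lemma collision_state_0 [simp]: "collision_state K h st 0 = st"
  by (simp add: collision_state_def)

lemma collision_state_add:
  "collision_state K h (collision_state K h st m) n = collision_state K h st (m + n)"
proof -
  have "(collide K h ^^ n) ((collide K h ^^ m) st) = (collide K h ^^ (n + m)) st"
    by (simp add: funpow_add)
  then show ?thesis by (simp add: collision_state_def add.commute)
qed

locale brick_billiard =
  fixes K :: nat and h \<theta>\<^sub>0 :: real
  assumes K: "1 \<le> K" and h: "0 \<le> h" and \<theta>\<^sub>0: "0 < \<theta>\<^sub>0" "\<theta>\<^sub>0 < pi / 2"
begin

lemma trig_pos: "0 < cos \<theta>\<^sub>0" "0 < sin \<theta>\<^sub>0" "0 < tan \<theta>\<^sub>0"
proof -
  show "0 < cos \<theta>\<^sub>0" using \<theta>\<^sub>0 by (intro cos_gt_zero_pi) auto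
  show "0 < sin \<theta>\<^sub>0" using \<theta>\<^sub>0 by (intro sin_gt_zero) auto
  show "0 < tan \<theta>\<^sub>0" using \<theta>\<^sub>0 by (intro tan_gt_zero) auto
qed

text \<open>The four directions of a trajectory, with representatives in \<open>[0, 2 \<pi>)\<close>; \<open>r\<close> means rightwards and
\<open>u\<close> upwards.\<close>

definition heading :: "bool \<Rightarrow> bool \<Rightarrow> real" where
  "heading r u = (if r then (if u then \<theta>\<^sub>0 else 2 * pi - \<theta>\<^sub>0) else (if u then pi - \<theta>\<^sub>0 else pi + \<theta>\<^sub>0))"

lemma velocity_heading: "velocity (heading r u) = (sg r * cos \<theta>\<^sub>0, sg u * sin \<theta>\<^sub>0)"
  by (simp add: velocity_def heading_def cos_add sin_add cos_diff sin_diff)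

lemma heading_bounds: "0 \<le> heading r u" "heading r u < 2 * pi"
  using \<theta>\<^sub>0 by (auto simp: heading_def)

lemma rmod_2pi: "0 \<le> t + 2 * pi * of_int k \<Longrightarrow> t + 2 * pi * of_int k < 2 * pi \<Longrightarrow> t rmod (2 * pi) = t + 2 * pi * of_int k"
  by (rule rmod_unique[of _ _ _ "- k"]) auto

lemma heading_reflected:
  "(pi - heading r u) rmod (2 * pi) = heading (\<not> r) u"
  "(- heading r u) rmod (2 * pi) = heading r (\<not> u)"
proof -
  show "(pi - heading r u) rmod (2 * pi) = heading (\<not> r) u"
    using rmod_2pi[of "pi - heading r u" 0] rmod_2pi[of "pi - heading r u" 1] \<theta>\<^sub>0
    by (cases r; cases u) (auto simp: heading_def)
  show "(- heading r u) rmod (2 * pi) = heading r (\<not> u)"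
    using rmod_2pi[of "- heading r u" 0] rmod_2pi[of "- heading r u" 1] \<theta>\<^sub>0
    by (cases r; cases u) (auto simp: heading_def)
qed

definition inside :: "state \<Rightarrow> bool" where
  "inside = (\<lambda>(p, \<eta>, \<theta>). p \<in> interior (domain K h \<eta>))"

text \<open>The condition that singles out \<open>Bstar\<close> among the regular states.\<close>

definition launching :: "state \<Rightarrow> bool" where
  "launching = (\<lambda>(p, \<eta>, \<theta>). snd p = - h \<and> \<theta> \<in> {\<theta>\<^sub>0, pi - \<theta>\<^sub>0})"

definition clear_leg :: "state \<Rightarrow> bool" where
  "clear_leg st \<longleftrightarrow> 0 < hit_time K h st \<and> (\<forall>u\<in>{0<..<hit_time K h st}. inside (advance u st))"

text \<open>The trajectory of \<open>st\<close> passes through \<open>st'\<close>, possibly in the middle of its leg number \<open>m\<close>, without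
having been on the floor with an upward velocity at any collision in between. Intermediate points
are allowed because the natural stages of the motion, such as entering a row, need not be collisions.\<close>

definition reaches :: "state \<Rightarrow> state \<Rightarrow> bool" where
  "reaches st st' \<longleftrightarrow> (\<exists>m s. 0 \<le> s \<and> st' = advance s (collision_state K h st m) \<and>
     (\<forall>u\<in>{0<..s}. inside (advance u (collision_state K h st m))) \<and>
     (\<forall>j<m. clear_leg (collision_state K h st j)) \<and>
     (\<forall>j\<in>{0<..m}. \<not> launching (collision_state K h st j)))"

text \<open>The state \<open>st'\<close> is the end point of a leg just before reflection and removal.\<close>

definition strikes :: "state \<Rightarrow> state \<Rightarrow> bool" where
  "strikes st st' \<longleftrightarrow> (\<exists>m. st' = advance (hit_time K h (collision_state K h st m)) (collision_state K h st m) \<and>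
     (\<forall>j\<le>m. clear_leg (collision_state K h st j)) \<and>
     (\<forall>j\<in>{0<..m}. \<not> launching (collision_state K h st j)))"

text \<open>As \<open>reaches\<close>, but \<open>st'\<close> is the state right after a collision and may itself be on the floor with an
upward velocity.\<close>

definition returns :: "state \<Rightarrow> state \<Rightarrow> bool" where
  "returns st st' \<longleftrightarrow> (\<exists>m. st' = collision_state K h st (Suc m) \<and>
     (\<forall>j\<le>m. clear_leg (collision_state K h st j)) \<and>
     (\<forall>j\<in>{0<..m}. \<not> launching (collision_state K h st j)))"

definition avoids_vertices :: "state \<Rightarrow> bool" where
  "avoids_vertices st \<longleftrightarrow> (\<forall>n. \<forall>s\<in>{0<..hit_time K h (collision_state K h st n)}.
        case advance s (collision_state K h st n) of (p, \<eta>, \<theta>) \<Rightarrow> p \<notin> vertices K h \<eta>)"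

lemma regular_iff: "regular K h st \<longleftrightarrow> admissible K h st \<and> avoids_vertices st"
  by (simp add: regular_def avoids_vertices_def)

lemma avoids_vertices_collision_state:
  "avoids_vertices st \<Longrightarrow> avoids_vertices (collision_state K h st m)"
  by (simp add: avoids_vertices_def collision_state_add)

lemma reaches_refl: "reaches st st"
  unfolding reaches_def by (rule exI[of _ 0], rule exI[of _ 0]) simp

lemma reaches_free:
  assumes "reaches st st'" "0 \<le> r" "\<And>u. 0 < u \<Longrightarrow> u \<le> r \<Longrightarrow> inside (advance u st')"
  shows "reaches st (advance r st')"
proof -
  obtain m s where ms: "0 \<le> s" "st' = advance s (collision_state K h st m)"
    "\<forall>u\<in>{0<..s}. inside (advance u (collision_state K h st m))"
    "\<forall>j<m. clear_leg (collision_state K h st j)"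
    "\<forall>j\<in>{0<..m}. \<not> launching (collision_state K h st j)"
    using assms(1) unfolding reaches_def by blast
  have "inside (advance u (collision_state K h st m))" if "u \<in> {0<..s + r}" for u
  proof (cases "u \<le> s")
    case True then show ?thesis using ms(3) that by simp
  next
    case False
    then have "inside (advance (u - s) st')" using that by (intro assms(3)) auto
    then show ?thesis by (simp add: ms(2) advance_advance)
  qed
  then show ?thesis
    unfolding reaches_def using ms assms(2)
    by (intro exI[of _ m] exI[of _ "s + r"]) (auto simp: advance_advance)
qed

text \<open>Interior points are not frontier points, so the hitting time is the first exit time.\<close>

lemma hit_time_eq:
  assumes "0 < r" "\<And>u. 0 < u \<Longrightarrow> u < r \<Longrightarrow> inside (advance u st)"
    and "case advance r st of (p, \<eta>, \<theta>) \<Rightarrow> p \<in> frontier (domain K h \<eta>)"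
  shows "hit_time K h st = r"
proof -
  obtain x \<eta> \<theta> where st: "st = (x, \<eta>, \<theta>)" by (cases st)
  have "Inf {s. 0 < s \<and> x + s *\<^sub>R velocity \<theta> \<in> frontier (domain K h \<eta>)} = r"
  proof (rule cInf_eq_minimum)
    show "r \<in> {s. 0 < s \<and> x + s *\<^sub>R velocity \<theta> \<in> frontier (domain K h \<eta>)}"
      using assms(1,3) by (simp add: st)
    fix s assume s: "s \<in> {s. 0 < s \<and> x + s *\<^sub>R velocity \<theta> \<in> frontier (domain K h \<eta>)}"
    show "r \<le> s"
    proof (rule ccontr)
      assume "\<not> r \<le> s"
      then have "inside (advance s st)" using s by (intro assms(2)) auto
      then show False using s by (simp add: st inside_def frontier_domain)
    qed
  qed
  then show ?thesis by (simp add: st)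
qed

lemma frontier_at_exit:
  assumes "0 < r" "\<And>u. 0 < u \<Longrightarrow> u < r \<Longrightarrow> inside (advance u st)" "\<not> inside (advance r st)"
  shows "case advance r st of (p, \<eta>, \<theta>) \<Rightarrow> p \<in> frontier (domain K h \<eta>)"
proof -
  obtain x \<eta> \<theta> where st: "st = (x, \<eta>, \<theta>)" by (cases st)
  have "\<forall>\<^sub>F s in at_right 0. (x + r *\<^sub>R velocity \<theta>) + s *\<^sub>R (- velocity \<theta>) \<in> interior (domain K h \<eta>)"
    unfolding eventually_at_right_field
  proof (intro exI[of _ r] conjI allI impI)
    fix s assume "0 < s" "s < r"
    then have "inside (advance (r - s) st)" by (intro assms(2)) auto
    then show "(x + r *\<^sub>R velocity \<theta>) + s *\<^sub>R (- velocity \<theta>) \<in> interior (domain K h \<eta>)"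
      by (simp add: st inside_def algebra_simps)
  qed (use assms in auto)
  then have "x + r *\<^sub>R velocity \<theta> \<in> domain K h \<eta>" by (rule domain_if_approached)
  then show ?thesis using assms(3) by (simp add: st inside_def frontier_domain)
qed

lemma reaches_strikes:
  assumes "reaches st st'" "0 < r" "\<And>u. 0 < u \<Longrightarrow> u < r \<Longrightarrow> inside (advance u st')"
    and "\<not> inside (advance r st')"
  shows "strikes st (advance r st')"
proof -
  obtain m s where ms: "0 \<le> s" "st' = advance s (collision_state K h st m)"
    "\<forall>u\<in>{0<..s}. inside (advance u (collision_state K h st m))"
    "\<forall>j<m. clear_leg (collision_state K h st j)"
    "\<forall>j\<in>{0<..m}. \<not> launching (collision_state K h st j)"
    using assms(1) unfolding reaches_def by blast
  let ?c = "collision_state K h st m"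
  have ins: "inside (advance u ?c)" if "0 < u" "u < s + r" for u
  proof (cases "u \<le> s")
    case True then show ?thesis using ms(3) that by simp
  next
    case False
    then have "inside (advance (u - s) st')" using that by (intro assms(3)) auto
    then show ?thesis by (simp add: ms(2) advance_advance)
  qed
  have ex: "\<not> inside (advance (s + r) ?c)" using assms(4) by (simp add: ms(2) advance_advance)
  have ht: "hit_time K h ?c = s + r"
    using ms(1) assms(2) by (intro hit_time_eq ins frontier_at_exit ex) auto
  have "clear_leg ?c" using ht ms(1) assms(2) ins by (simp add: clear_leg_def)
  then have "\<forall>j\<le>m. clear_leg (collision_state K h st j)" using ms(4) by (auto simp: le_less)
  then show ?thesis unfolding strikes_def using ms(5)
    by (intro exI[of _ m]) (simp add: ht ms(2) advance_advance)
qed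

text \<open>The end point of a leg is one of the points from which \<open>avoids_vertices\<close> excludes vertices. This is how
regularity rules out the ambiguous collisions.\<close>

lemma strikes_not_vertex:
  assumes "avoids_vertices st" "strikes st (p, \<eta>, \<theta>)"
  shows "p \<notin> vertices K h \<eta>"
proof -
  obtain m where m: "(p, \<eta>, \<theta>) = advance (hit_time K h (collision_state K h st m)) (collision_state K h st m)"
    "clear_leg (collision_state K h st m)"
    using assms(2) unfolding strikes_def by blast
  then have "hit_time K h (collision_state K h st m) \<in> {0<..hit_time K h (collision_state K h st m)}"
    by (simp add: clear_leg_def)
  then have "case (p, \<eta>, \<theta>) of (p, \<eta>, \<theta>) \<Rightarrow> p \<notin> vertices K h \<eta>"
    using assms(1) m(1) unfolding avoids_vertices_def by metis
  then show ?thesis by simp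
qed

lemma strikes_returns:
  assumes "strikes st (p, \<eta>, \<theta>)"
  shows "returns st (p, remove_hit K p \<eta>, reflect K h \<eta> p \<theta>)"
proof -
  obtain m where m: "(p, \<eta>, \<theta>) = advance (hit_time K h (collision_state K h st m)) (collision_state K h st m)"
    "\<forall>j\<le>m. clear_leg (collision_state K h st j)"
    "\<forall>j\<in>{0<..m}. \<not> launching (collision_state K h st j)"
    using assms unfolding strikes_def by blast
  have "collision_state K h st (Suc m) = (p, remove_hit K p \<eta>, reflect K h \<eta> p \<theta>)"
    unfolding collision_state_Suc collide_def by (simp flip: m(1))
  then show ?thesis unfolding returns_def using m(2,3) by (intro exI[of _ m]) auto
qed

lemma returns_reaches:
  assumes "returns st st'" "\<not> launching st'"
  shows "reaches st st'"
proof -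
  obtain m where m: "st' = collision_state K h st (Suc m)"
    "\<forall>j\<le>m. clear_leg (collision_state K h st j)"
    "\<forall>j\<in>{0<..m}. \<not> launching (collision_state K h st j)"
    using assms unfolding returns_def by blast
  then have "\<forall>j\<in>{0<..Suc m}. \<not> launching (collision_state K h st j)"
    using assms(2) by (metis greaterThanAtMost_iff le_Suc_eq)
  then show ?thesis unfolding reaches_def using m
    by (intro exI[of _ "Suc m"] exI[of _ 0]) (auto simp: less_Suc_eq_le)
qed

section \<open>Free flight, walls and brick sides\<close>

text \<open>The states that occur, in unfolded coordinates: \<open>X\<close> determines both the position in the strip and the
horizontal direction.\<close>

definition mover :: "real \<Rightarrow> real \<Rightarrow> config \<Rightarrow> bool \<Rightarrow> state" where
  "mover X y \<eta> u = ((fold_pos K X, y), \<eta>, heading (rightward K \<lfloor>X\<rfloor>) u)"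

lemma mover_period: "mover (X + 2 * real K * of_int q) y \<eta> u = mover X y \<eta> u"
proof -
  have "\<lfloor>X + 2 * real K * of_int q\<rfloor> = \<lfloor>X + of_int (2 * int K * q)\<rfloor>" by simp
  also have "\<dots> = \<lfloor>X\<rfloor> + 2 * int K * q" by (rule floor_add_int[symmetric])
  finally show ?thesis by (simp add: mover_def fold_pos_period)
qed

lemma advance_mover:
  assumes "of_int c \<le> X" "X < of_int c + 1" "0 \<le> d" "X + d \<le> of_int c + 1"
  shows "advance (d / cos \<theta>\<^sub>0) (mover X y \<eta> u) =
    ((fold_pos K (X + d), y + sg u * (d * tan \<theta>\<^sub>0)), \<eta>, heading (rightward K c) u)"
proof -
  have "\<lfloor>X\<rfloor> = c" using assms by linarith
  then show ?thesis
    using trig_pos fold_pos_add[OF K assms(1,3,4)]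
    by (simp add: mover_def velocity_heading tan_def)
qed

lemma inside_layered:
  "B \<subseteq> {..<K} \<Longrightarrow> inside (p, layered K L B, \<theta>) \<longleftrightarrow> p \<in> free_region K h L B"
  by (simp add: inside_def interior_domain_layered[OF K])

lemma inside_imp_above: "inside ((x, y), layered K L B, \<theta>) \<Longrightarrow> B \<subseteq> {..<K} \<Longrightarrow> - h < y"
  by (simp add: inside_layered free_region_def)

definition passable :: "nat \<Rightarrow> nat set \<Rightarrow> int \<Rightarrow> real \<Rightarrow> bool" where
  "passable L B c y \<longleftrightarrow> - h < y \<and> y < real L + 1 \<and> (y < real L \<or> cell K c \<notin> B)"

lemma passable_below: "- h < y \<Longrightarrow> y < real L \<Longrightarrow> passable L B c y"
  by (simp add: passable_def)

lemma passable_nearby: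
  assumes "passable L B c y"
  obtains e where "0 < e" "\<And>s. \<bar>s\<bar> < e \<Longrightarrow> passable L B c (y + s)"
proof (cases "y < real L")
  case True
  then show thesis using assms
    by (intro that[of "min (y + h) (real L - y)"]) (auto simp: passable_def)
next
  case False
  then show thesis using assms
    by (intro that[of "min (y + h) (real L + 1 - y)"]) (auto simp: passable_def)
qed

lemma inside_in_cell:
  assumes B: "B \<subseteq> {..<K}" and X: "of_int c < X" "X < of_int c + 1" and p: "passable L B c y"
  shows "inside ((fold_pos K X, y), layered K L B, \<theta>)"
proof -
  note i = fold_pos_interior[OF K X]
  have "real (cell K c) + 1 \<le> real K" using cell_less[OF K, of c] by linarith
  moreover have sep: "fold_pos K X < real k \<or> real k + 1 < fold_pos K X" if "k \<noteq> cell K c" for k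
  proof (cases "k < cell K c")
    case True
    then have "real k + 1 \<le> real (cell K c)" by linarith
    then show ?thesis using i by linarith
  next
    case False
    then have "real (cell K c) + 1 \<le> real k" using that by linarith
    then show ?thesis using i by linarith
  qed
  moreover have "fold_pos K X < real k \<or> real k + 1 < fold_pos K X" if "k \<in> B" "real L \<le> y" for k
    using p that by (intro sep) (auto simp: passable_def)
  ultimately show ?thesis
    using i p unfolding inside_layered[OF B] free_region_def passable_def by auto
qed

text \<open>Crossing from one cell to the next, other than at a wall.\<close>

lemma inside_between_cells:
  assumes B: "B \<subseteq> {..<K}" and same: "rightward K c = rightward K (c + 1)"
    and p: "passable L B c y" "passable L B (c + 1) y"
  shows "inside ((fold_pos K (of_int c + 1), y), layered K L B, \<theta>)"
proof -
  have "fold_pos K (of_int c + 1) = (if rightward K c then real (cell K c) + 1 else real (cell K c))"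
    using fold_pos_in_cell[OF K, of c "of_int c + 1"] by simp
  then have "0 < fold_pos K (of_int c + 1)" "fold_pos K (of_int c + 1) < real K"
    using same cell_less[OF K, of c] cell_less[OF K, of "c + 1"]
    by (cases rule: succ_cell[OF K, of c]; simp)+
  moreover have "fold_pos K (of_int c + 1) < real k \<or> real k + 1 < fold_pos K (of_int c + 1)"
    if "k \<in> B" "real L \<le> y" for k
  proof -
    have "k \<noteq> cell K c" "k \<noteq> cell K (c + 1)" "k < K" using that p B by (auto simp: passable_def)
    then show ?thesis using fold_pos_boundary[OF K, of k c] by force
  qed
  ultimately show ?thesis
    using p unfolding inside_layered[OF B] free_region_def passable_def by auto
qed

lemma not_inside_wall:
  assumes B: "B \<subseteq> {..<K}" and "rightward K c \<noteq> rightward K (c + 1)"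
  shows "\<not> inside ((fold_pos K (of_int c + 1), y), layered K L B, \<theta>)"
  using fold_pos_at_wall[OF K assms(2)] by (auto simp: inside_layered[OF B] free_region_def)

lemma not_inside_brick:
  assumes "B \<subseteq> {..<K}" "k \<in> B" "real k \<le> x" "x \<le> real k + 1" "real L \<le> y"
  shows "\<not> inside ((x, y), layered K L B, \<theta>)"
  using assms(2-) unfolding inside_layered[OF assms(1)] free_region_def by fastforce

text \<open>Near the end of a passable cell the domain lies on one side only of a vertical line, so the frontier contains a
vertical segment.\<close>

lemma reflect_at_side:
  assumes B: "B \<subseteq> {..<K}" and p: "passable L B c y" and e: "0 < e"
    and out: "\<And>s. \<bar>s\<bar> < e \<Longrightarrow> \<not> inside ((fold_pos K (of_int c + 1), y + s), layered K L B, 0)"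
  shows "reflect K h (layered K L B) (fold_pos K (of_int c + 1), y) (heading r u) = heading (\<not> r) u"
proof -
  obtain e' where e': "0 < e'" "\<And>s. \<bar>s\<bar> < e' \<Longrightarrow> passable L B c (y + s)"
    using passable_nearby[OF p] by blast
  have "on_vertical_side K h (layered K L B) (fold_pos K (of_int c + 1), y)"
    unfolding on_vertical_side_def
  proof (intro exI[of _ "min e e'"] conjI allI impI)
    show "0 < min e e'" using e e' by simp
    fix s assume s: "\<bar>s\<bar> < min e e'"
    let ?p = "(fold_pos K (of_int c + 1), y) + (0, s)"
    let ?v = "(- sg (rightward K c), 0 :: real)"
    have "\<forall>\<^sub>F t in at_right 0. ?p + t *\<^sub>R ?v \<in> interior (domain K h (layered K L B))"
      unfolding eventually_at_right_field
    proof (intro exI[of _ 1] conjI allI impI)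
      fix t :: real assume t: "0 < t" "t < 1"
      have "fold_pos K (of_int c + 1 - t + t) = fold_pos K (of_int c + 1 - t) + sg (rightward K c) * t"
        using t by (intro fold_pos_add[OF K]) auto
      moreover have "inside ((fold_pos K (of_int c + 1 - t), y + s), layered K L B, 0)"
        using t e'(2) s by (intro inside_in_cell[OF B, of c]) auto
      ultimately show "?p + t *\<^sub>R ?v \<in> interior (domain K h (layered K L B))"
        by (simp add: inside_def algebra_simps)
    qed simp
    then have "?p \<in> domain K h (layered K L B)" by (rule domain_if_approached)
    moreover have "?p \<notin> interior (domain K h (layered K L B))"
      using out[of s] s by (simp add: inside_def)
    ultimately show "?p \<in> frontier (domain K h (layered K L B))" by (simp add: frontier_domain)
  qed
  then show ?thesis by (simp add: reflect_def heading_reflected)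
qed

text \<open>The points just behind a particle that hits a horizontal side lie in the interior and on the vertical line
through the hit point, so that line is not contained in the frontier near the hit point.\<close>

lemma reflect_at_floor_or_ceiling:
  assumes "0 < e" "\<And>t. 0 < t \<Longrightarrow> t < e \<Longrightarrow> inside ((x, y - sg u * t), \<eta>, 0)"
  shows "reflect K h \<eta> (x, y) (heading r u) = heading r (\<not> u)"
proof -
  have "\<not> on_vertical_side K h \<eta> (x, y)"
  proof
    assume "on_vertical_side K h \<eta> (x, y)"
    then obtain e' where e': "0 < e'" "\<And>s. \<bar>s\<bar> < e' \<Longrightarrow> (x, y) + (0, s) \<in> frontier (domain K h \<eta>)"
      unfolding on_vertical_side_def by blast
    define t where "t = min e e' / 2"
    have t: "0 < t" "t < e" "t < e'" using assms(1) e'(1) by (auto simp: t_def)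
    have "(x, y) + (0, - sg u * t) \<in> frontier (domain K h \<eta>)"
      using t by (intro e'(2)) (auto simp: sg_def)
    then show False using assms(2)[OF t(1,2)] by (simp add: inside_def frontier_domain)
  qed
  then show ?thesis by (simp add: reflect_def heading_reflected)
qed

text \<open>At an integer abscissa the only bricks of row \<open>L\<close> within reach are those of the two adjacent cells.\<close>

lemma removed_at_boundary:
  assumes B: "B \<subseteq> {..<K}" and y: "y < real L + 1"
  shows "remove_hit K (fold_pos K (of_int c + 1), y) (layered K L B) =
    layered K L (if y < real L then B else B - {cell K c, cell K (c + 1)})"
proof -
  have "B - {k. (fold_pos K (of_int c + 1), y) \<in> brick (k, L)} =
    (if y < real L then B else B - {cell K c, cell K (c + 1)})"
    using B y fold_pos_boundary[OF K, of _ c] by (auto simp: mem_brick_iff)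
  then show ?thesis using remove_hit_layered[OF B] y by simp
qed

lemma not_launching_above: "- h < y \<Longrightarrow> \<not> launching ((x, y), \<eta>, \<theta>)"
  by (simp add: launching_def)

lemma not_launching_down: "\<not> launching (p, \<eta>, heading r False)"
  using \<theta>\<^sub>0 by (simp add: launching_def heading_def split: prod.splits)

text \<open>Motion within one unit cell, including its end point: there the particle passes into
the next cell or is reflected at a wall, and neither case is visible in the unfolded coordinate.\<close>

lemma reaches_cell_move:
  assumes B: "B \<subseteq> {..<K}" and X: "of_int c \<le> X" "X < of_int c + 1" "0 \<le> d" "X + d \<le> of_int c + 1"
    and re: "reaches st (mover X y (layered K L B) u)"
    and path: "\<And>t. 0 < t \<Longrightarrow> t \<le> d \<Longrightarrow> passable L B c (y + sg u * (t * tan \<theta>\<^sub>0))"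
    and goal: "passable L B \<lfloor>X + d\<rfloor> (y + sg u * (d * tan \<theta>\<^sub>0))"
  shows "reaches st (mover (X + d) (y + sg u * (d * tan \<theta>\<^sub>0)) (layered K L B) u)"
proof -
  let ?s = "mover X y (layered K L B) u" and ?y = "y + sg u * (d * tan \<theta>\<^sub>0)"
  have adv: "advance (d' / cos \<theta>\<^sub>0) ?s = ((fold_pos K (X + d'), y + sg u * (d' * tan \<theta>\<^sub>0)), layered K L B, heading (rightward K c) u)"
    if "0 \<le> d'" "d' \<le> d" for d'
    using that X by (intro advance_mover) auto
  have conv: "t \<le> d / cos \<theta>\<^sub>0 \<longleftrightarrow> t * cos \<theta>\<^sub>0 \<le> d" "t < d / cos \<theta>\<^sub>0 \<longleftrightarrow> t * cos \<theta>\<^sub>0 < d" for t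
    using trig_pos by (simp_all add: pos_le_divide_eq pos_less_divide_eq)
  have before: "inside (advance t ?s)" if t: "0 < t" "t \<le> d / cos \<theta>\<^sub>0" "X + t * cos \<theta>\<^sub>0 < of_int c + 1" for t
  proof -
    define d' where "d' = t * cos \<theta>\<^sub>0"
    have d': "0 < d'" "d' \<le> d" "t = d' / cos \<theta>\<^sub>0" "X + d' < of_int c + 1"
      using t trig_pos conv by (auto simp: d'_def)
    have "inside ((fold_pos K (X + d'), y + sg u * (d' * tan \<theta>\<^sub>0)), layered K L B, heading (rightward K c) u)"
      using d' X by (intro inside_in_cell[OF B, of c] path) auto
    then show ?thesis using adv[of d'] d' by simp
  qed
  consider (zero) "d = 0" | (within) "0 < d" "X + d < of_int c + 1"
    | (pass) "0 < d" "X + d = of_int c + 1" "rightward K c = rightward K (c + 1)"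
    | (wall) "0 < d" "X + d = of_int c + 1" "rightward K c \<noteq> rightward K (c + 1)"
    using X by linarith
  then show ?thesis
  proof cases
    case zero
    then show ?thesis using re by simp
  next
    case within
    have "inside (advance t ?s)" if t: "0 < t" "t \<le> d / cos \<theta>\<^sub>0" for t
    proof (rule before[OF t])
      show "X + t * cos \<theta>\<^sub>0 < of_int c + 1" using t(2) within unfolding conv by linarith
    qed
    then have "reaches st (advance (d / cos \<theta>\<^sub>0) ?s)"
      using trig_pos within by (intro reaches_free[OF re]) auto
    moreover have "\<lfloor>X + d\<rfloor> = c" using within X by linarith
    ultimately show ?thesis unfolding adv[OF X(3) order_refl] by (simp add: mover_def)
  next
    case pass
    have fl: "\<lfloor>X + d\<rfloor> = c + 1" using pass by simp
    have "inside (advance t ?s)" if t: "0 < t" "t \<le> d / cos \<theta>\<^sub>0" for t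
    proof (cases "t = d / cos \<theta>\<^sub>0")
      case True
      have "inside ((fold_pos K (X + d), ?y), layered K L B, heading (rightward K c) u)"
        unfolding pass(2) using goal pass path[of d] unfolding fl by (intro inside_between_cells[OF B]) auto
      then show ?thesis using adv[of d] X True by simp
    next
      case False
      then have "t < d / cos \<theta>\<^sub>0" using t by simp
      then have "X + t * cos \<theta>\<^sub>0 < of_int c + 1" using pass unfolding conv by linarith
      then show ?thesis using t by (intro before)
    qed
    then have "reaches st (advance (d / cos \<theta>\<^sub>0) ?s)"
      using trig_pos pass by (intro reaches_free[OF re]) auto
    then show ?thesis using pass(3) unfolding adv[OF X(3) order_refl] by (simp add: mover_def fl)
  next
    case wall
    have fl: "\<lfloor>X + d\<rfloor> = c + 1" using wall by simp
    have cells: "cell K (c + 1) = cell K c" using wall(3) by (cases rule: succ_cell[OF K, of c]) auto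
    have pass': "passable L B c ?y" using path[of d] wall by simp
    have "strikes st (advance (d / cos \<theta>\<^sub>0) ?s)"
    proof (rule reaches_strikes[OF re])
      show "0 < d / cos \<theta>\<^sub>0" using trig_pos wall by simp
      show "inside (advance t ?s)" if t: "0 < t" "t < d / cos \<theta>\<^sub>0" for t
      proof (rule before[OF t(1)])
        show "t \<le> d / cos \<theta>\<^sub>0" using t by simp
        show "X + t * cos \<theta>\<^sub>0 < of_int c + 1" using t(2) wall unfolding conv by linarith
      qed
      show "\<not> inside (advance (d / cos \<theta>\<^sub>0) ?s)"
        using adv[of d] X not_inside_wall[OF B wall(3)] by (simp add: wall(2))
    qed
    then have st: "strikes st ((fold_pos K (of_int c + 1), ?y), layered K L B, heading (rightward K c) u)"
      using adv[of d] X by (simp add: wall(2))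
    have "reflect K h (layered K L B) (fold_pos K (of_int c + 1), ?y) (heading (rightward K c) u)
      = heading (\<not> rightward K c) u"
      using not_inside_wall[OF B wall(3)] by (intro reflect_at_side[OF B pass', of 1]) auto
    moreover have "remove_hit K (fold_pos K (of_int c + 1), ?y) (layered K L B) = layered K L B"
    proof -
      have "(if ?y < real L then B else B - {cell K c, cell K (c + 1)}) = B"
        using pass' by (auto simp: passable_def cells)
      then show ?thesis using removed_at_boundary[OF B, of ?y L c] pass' by (simp add: passable_def)
    qed
    ultimately have "returns st ((fold_pos K (of_int c + 1), ?y), layered K L B, heading (\<not> rightward K c) u)"
      using strikes_returns[OF st] by simp
    then have "reaches st ((fold_pos K (of_int c + 1), ?y), layered K L B, heading (\<not> rightward K c) u)"
      using pass' by (intro returns_reaches not_launching_above) (auto simp: passable_def)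
    then show ?thesis using wall(3) by (simp add: mover_def fl wall(2))
  qed
qed

text \<open>Hitting the side of a brick inverts the unfolded coordinate: \<open>c + 1\<close> becomes \<open>- 1 - c\<close>.\<close>

lemma reaches_side_hit:
  assumes B: "B \<subseteq> {..<K}" and X: "of_int c \<le> X" "X < of_int c + 1"
    and y': "y' = y + (of_int c + 1 - X) * tan \<theta>\<^sub>0" "- h \<le> y" "real L < y'" "y' < real L + 1"
    and gap: "cell K c \<notin> B" "cell K (c + 1) \<in> B"
    and re: "reaches st (mover X y (layered K L B) True)"
  shows "reaches st (mover (of_int (- 1 - c)) y' (layered K L (B - {cell K (c + 1)})) True)"
proof -
  let ?s = "mover X y (layered K L B) True" and ?d = "of_int c + 1 - X"
  have d: "0 < ?d" using X by simp
  have adv: "advance (d' / cos \<theta>\<^sub>0) ?s = ((fold_pos K (X + d'), y + d' * tan \<theta>\<^sub>0), layered K L B, heading (rightward K c) True)"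
    if "0 \<le> d'" "d' \<le> ?d" for d'
    using that X advance_mover[of c X d' y _ True] by auto
  have pass: "passable L B c (y + t * tan \<theta>\<^sub>0)" if "0 < t" "t \<le> ?d" for t
  proof -
    have "t * tan \<theta>\<^sub>0 \<le> ?d * tan \<theta>\<^sub>0" using that trig_pos by (intro mult_right_mono) auto
    moreover have "0 < t * tan \<theta>\<^sub>0" using that trig_pos by simp
    ultimately show ?thesis using y' gap by (auto simp: passable_def)
  qed
  have out: "\<not> inside ((fold_pos K (of_int c + 1), w), layered K L B, \<theta>)" if "real L \<le> w" for w \<theta>
    using fold_pos_boundary[OF K cell_less[OF K], of "c + 1" c] that
    by (intro not_inside_brick[OF B gap(2)]) auto
  have "strikes st (advance (?d / cos \<theta>\<^sub>0) ?s)"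
  proof (rule reaches_strikes[OF re])
    show "0 < ?d / cos \<theta>\<^sub>0" using d trig_pos by simp
    show "inside (advance t ?s)" if t: "0 < t" "t < ?d / cos \<theta>\<^sub>0" for t
    proof -
      define d' where "d' = t * cos \<theta>\<^sub>0"
      have d': "0 < d'" "d' < ?d" "t = d' / cos \<theta>\<^sub>0"
        using t trig_pos by (auto simp: d'_def pos_less_divide_eq)
      have "inside ((fold_pos K (X + d'), y + d' * tan \<theta>\<^sub>0), layered K L B, heading (rightward K c) True)"
        using d' X by (intro inside_in_cell[OF B, of c] pass) auto
      then show ?thesis using adv[of d'] d' by simp
    qed
    show "\<not> inside (advance (?d / cos \<theta>\<^sub>0) ?s)"
      using adv[of ?d] d out[of y'] y' by simp
  qed
  then have st: "strikes st ((fold_pos K (of_int c + 1), y'), layered K L B, heading (rightward K c) True)"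
    using adv[of ?d] d y'(1) by simp
  have "reflect K h (layered K L B) (fold_pos K (of_int c + 1), y') (heading (rightward K c) True)
    = heading (\<not> rightward K c) True"
    using pass[of ?d] d y' out by (intro reflect_at_side[OF B, of _ _ _ "y' - real L"]) auto
  moreover have "remove_hit K (fold_pos K (of_int c + 1), y') (layered K L B) = layered K L (B - {cell K (c + 1)})"
  proof -
    have "B - {cell K c, cell K (c + 1)} = B - {cell K (c + 1)}" using gap by auto
    then show ?thesis using removed_at_boundary[OF B, of y' L c] y' by simp
  qed
  ultimately have "returns st ((fold_pos K (of_int c + 1), y'), layered K L (B - {cell K (c + 1)}), heading (\<not> rightward K c) True)"
    using strikes_returns[OF st] by simp
  then have re': "reaches st ((fold_pos K (of_int c + 1), y'), layered K L (B - {cell K (c + 1)}), heading (\<not> rightward K c) True)"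
    using y' h by (intro returns_reaches not_launching_above) auto
  have "fold_pos K (of_int (- 1 - c)) = fold_pos K (of_int c + 1)"
    using fold_pos_in_cell[OF K, of c "of_int c + 1"] fold_pos_in_cell[OF K, of "- 1 - c" "of_int (- 1 - c)"]
    by (simp add: reversed_cell[OF K])
  then show ?thesis
    using re' unfolding mover_def floor_of_int by (simp only: reversed_cell[OF K])
qed

lemma reaches_walk_step:
  assumes B: "B \<subseteq> {..<K}" and X: "of_int c \<le> X" "X < of_int c + 1"
    and y: "real L \<le> y" "y + (of_int c + 1 - X) * tan \<theta>\<^sub>0 < real L + 1"
    and gap: "cell K c \<notin> B"
    and re: "reaches st (mover X y (layered K L B) True)"
    and step: "walk_step K (B, c) = (B', c')"
  shows "reaches st (mover (of_int c') (y + (of_int c + 1 - X) * tan \<theta>\<^sub>0) (layered K L B') True)"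
proof -
  let ?d = "of_int c + 1 - X"
  have d: "0 < ?d" using X by simp
  have rise: "0 < t * tan \<theta>\<^sub>0 \<and> t * tan \<theta>\<^sub>0 \<le> ?d * tan \<theta>\<^sub>0" if "0 < t" "t \<le> ?d" for t
    using that trig_pos by (auto intro!: mult_right_mono)
  show ?thesis
  proof (cases "cell K (c + 1) \<in> B")
    case True
    then have "B' = B - {cell K (c + 1)}" "c' = - 1 - c" using step by (auto simp: walk_step_def)
    moreover have "reaches st (mover (of_int (- 1 - c)) (y + ?d * tan \<theta>\<^sub>0) (layered K L (B - {cell K (c + 1)})) True)"
      using y h rise[OF d order_refl] by (intro reaches_side_hit[OF B X refl _ _ _ gap True re]) auto
    ultimately show ?thesis by simp
  next
    case False
    then have "B' = B" "c' = c + 1" using step by (auto simp: walk_step_def)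
    moreover have "reaches st (mover (X + ?d) (y + sg True * (?d * tan \<theta>\<^sub>0)) (layered K L B) True)"
    proof (rule reaches_cell_move[OF B X _ _ re])
      show "passable L B c (y + sg True * (t * tan \<theta>\<^sub>0))" if "0 < t" "t \<le> ?d" for t
        using rise[OF that] gap y h by (auto simp: passable_def)
      show "passable L B \<lfloor>X + ?d\<rfloor> (y + sg True * (?d * tan \<theta>\<^sub>0))"
        using rise[OF d order_refl] False y h by (auto simp: passable_def)
    qed (use d in auto)
    ultimately show ?thesis by simp
  qed
qed

text \<open>The particle follows the walk. Its first step is shortened by \<open>frac X\<close>, because the particle enters the row
inside a cell; every later step starts at an integer. The height condition keeps it below level \<open>L + 1\<close>.\<close>

lemma reaches_walk:
  assumes B: "B \<subseteq> {..<K}" and gap: "cell K \<lfloor>X\<rfloor> \<notin> B"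
    and re: "reaches st (mover X (real L) (layered K L B) True)"
    and n: "1 \<le> n" "(real n - frac X) * tan \<theta>\<^sub>0 < 1"
    and step: "(walk_step K ^^ n) (B, \<lfloor>X\<rfloor>) = (B', c')"
  shows "reaches st (mover (of_int c') (real L + (real n - frac X) * tan \<theta>\<^sub>0) (layered K L B') True)"
  using n step
proof (induction n arbitrary: B' c' rule: nat_induct_at_least)
  case base
  then have "walk_step K (B, \<lfloor>X\<rfloor>) = (B', c')" by simp
  moreover have e: "real 1 - frac X = of_int \<lfloor>X\<rfloor> + 1 - X" by (simp add: frac_def)
  moreover have "real L + (of_int \<lfloor>X\<rfloor> + 1 - X) * tan \<theta>\<^sub>0 < real L + 1" using base(1) unfolding e by simp
  ultimately show ?case
    unfolding e using reaches_walk_step[OF B _ _ _ _ gap re, of B' c'] by simp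
next
  case (Suc n)
  obtain B1 c1 where 1: "(walk_step K ^^ n) (B, \<lfloor>X\<rfloor>) = (B1, c1)" by fastforce
  have f: "0 \<le> frac X" "frac X < 1" by (simp_all add: frac_lt_1)
  have "(real n - frac X) * tan \<theta>\<^sub>0 \<le> (real (Suc n) - frac X) * tan \<theta>\<^sub>0"
    using trig_pos by (intro mult_right_mono) auto
  then have re1: "reaches st (mover (of_int c1) (real L + (real n - frac X) * tan \<theta>\<^sub>0) (layered K L B1) True)"
    using Suc 1 by simp
  have inv: "B1 \<subseteq> {..<K}" "cell K c1 \<notin> B1"
    using walk_stays_in_gap[OF K B gap 1] by auto
  have "0 \<le> (real n - frac X) * tan \<theta>\<^sub>0" using f trig_pos Suc.hyps by (intro mult_nonneg_nonneg) auto
  moreover have "walk_step K (B1, c1) = (B', c')" using Suc.prems 1 by simp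
  moreover have "(real n - frac X) * tan \<theta>\<^sub>0 + (of_int c1 + 1 - of_int c1) * tan \<theta>\<^sub>0 = (real (Suc n) - frac X) * tan \<theta>\<^sub>0"
    by (simp add: algebra_simps)
  ultimately show ?case
    using reaches_walk_step[OF inv(1) _ _ _ _ inv(2) re1, of B' c'] Suc.prems by (simp add: add.assoc)
qed

text \<open>Between the floor and level \<open>L\<close> the strip is empty, so the flight is a concatenation of cell moves.\<close>

lemma reaches_fly:
  assumes B: "B \<subseteq> {..<K}" and d: "0 \<le> d"
    and re: "reaches st (mover X y (layered K L B) u)"
    and path: "\<And>t. 0 < t \<Longrightarrow> t \<le> d \<Longrightarrow> - h < y + sg u * (t * tan \<theta>\<^sub>0) \<and> y + sg u * (t * tan \<theta>\<^sub>0) < real L"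
  shows "reaches st (mover (X + d) (y + sg u * (d * tan \<theta>\<^sub>0)) (layered K L B) u)"
  using d re path
proof (induction "nat (\<lfloor>X + d\<rfloor> - \<lfloor>X\<rfloor>)" arbitrary: X y d rule: less_induct)
  case less
  show ?case
  proof (cases "d = 0")
    case True
    then show ?thesis using less.prems by simp
  next
    case False
    then have d0: "0 < d" using less.prems by simp
    define c where "c = \<lfloor>X\<rfloor>"
    have X: "of_int c \<le> X" "X < of_int c + 1" by (simp_all add: c_def)
    show ?thesis
    proof (cases "X + d \<le> of_int c + 1")
      case True
      show ?thesis
        using less.prems(3) d0 by (intro reaches_cell_move[OF B X _ True less.prems(2)] passable_below) auto
    next
      case False
      define d1 where "d1 = of_int c + 1 - X"
      have d1: "0 < d1" "d1 < d" "X + d1 = of_int (c + 1)" using X False by (auto simp: d1_def)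
      have r1: "reaches st (mover (X + d1) (y + sg u * (d1 * tan \<theta>\<^sub>0)) (layered K L B) u)"
        using less.prems(3) d1 by (intro reaches_cell_move[OF B X _ _ less.prems(2)] passable_below) auto
      have m1: "nat (\<lfloor>X + d1 + (d - d1)\<rfloor> - \<lfloor>X + d1\<rfloor>) < nat (\<lfloor>X + d\<rfloor> - \<lfloor>X\<rfloor>)"
      proof -
        have "\<lfloor>X + d1\<rfloor> = \<lfloor>X\<rfloor> + 1" using d1(3) by (simp add: c_def)
        moreover have "\<lfloor>X\<rfloor> + 1 \<le> \<lfloor>X + d\<rfloor>" using False by (simp add: c_def le_floor_iff)
        ultimately show ?thesis by simp
      qed
      have p1: "- h < y + sg u * (d1 * tan \<theta>\<^sub>0) + sg u * (t * tan \<theta>\<^sub>0) \<and>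
          y + sg u * (d1 * tan \<theta>\<^sub>0) + sg u * (t * tan \<theta>\<^sub>0) < real L" if "0 < t" "t \<le> d - d1" for t
        using less.prems(3)[of "d1 + t"] that d1 by (simp add: algebra_simps)
      have "reaches st (mover (X + d1 + (d - d1)) (y + sg u * (d1 * tan \<theta>\<^sub>0) + sg u * ((d - d1) * tan \<theta>\<^sub>0)) (layered K L B) u)"
        using d1 by (intro less.hyps[OF m1 _ r1 p1]) auto
      then show ?thesis by (simp add: algebra_simps)
    qed
  qed
qed

section \<open>Ceiling, floor and gaps\<close>

text \<open>The flight is cut at the beginning of the last unit cell it crosses: from there to the hit point it is a
straight segment. A hit point on a side wall would be a vertex, so the direction of
motion at the hit is the one read off from \<open>X + D\<close>.\<close>

lemma returns_at_floor_or_ceiling: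
  assumes B: "B \<subseteq> {..<K}" and av: "avoids_vertices st" and D: "0 < D"
    and re: "reaches st (mover X y (layered K L B) u)"
    and path: "\<And>t. 0 < t \<Longrightarrow> t < D \<Longrightarrow> - h < y + sg u * (t * tan \<theta>\<^sub>0) \<and> y + sg u * (t * tan \<theta>\<^sub>0) < real L"
    and Y: "Y = y + sg u * (D * tan \<theta>\<^sub>0)"
    and out: "\<And>\<theta>. \<not> inside ((fold_pos K (X + D), Y), layered K L B, \<theta>)"
    and corner: "fold_pos K (X + D) \<in> {0, real K} \<Longrightarrow> (fold_pos K (X + D), Y) \<in> vertices K h (layered K L B)"
  shows "(fold_pos K (X + D), Y) \<notin> vertices K h (layered K L B)"
    and "returns st (mover (X + D) Y (remove_hit K (fold_pos K (X + D), Y) (layered K L B)) (\<not> u))"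
proof -
  define c where "c = \<lceil>X + D\<rceil> - 1"
  have c: "of_int c < X + D" "X + D \<le> of_int c + 1" unfolding c_def by linarith+
  define d where "d = max 0 (of_int c - X)"
  have d: "0 \<le> d" "d < D" "of_int c \<le> X + d" using c D by (auto simp: d_def)
  let ?s = "mover (X + d) (y + sg u * (d * tan \<theta>\<^sub>0)) (layered K L B) u"
  have re': "reaches st ?s"
    using path d by (intro reaches_fly[OF B d(1) re]) auto
  have adv: "advance (t / cos \<theta>\<^sub>0) ?s = ((fold_pos K (X + d + t), y + sg u * ((d + t) * tan \<theta>\<^sub>0)), layered K L B, heading (rightward K c) u)"
    if "0 \<le> t" "t \<le> D - d" for t
    using that c d advance_mover[of c "X + d" t] by (simp add: algebra_simps)
  have "strikes st (advance ((D - d) / cos \<theta>\<^sub>0) ?s)"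
  proof (rule reaches_strikes[OF re'])
    show "0 < (D - d) / cos \<theta>\<^sub>0" using d trig_pos by simp
    show "inside (advance t ?s)" if t: "0 < t" "t < (D - d) / cos \<theta>\<^sub>0" for t
    proof -
      define d' where "d' = t * cos \<theta>\<^sub>0"
      have d': "0 < d'" "d' < D - d" "t = d' / cos \<theta>\<^sub>0"
        using t trig_pos by (auto simp: d'_def pos_less_divide_eq)
      have "inside ((fold_pos K (X + d + d'), y + sg u * ((d + d') * tan \<theta>\<^sub>0)), layered K L B, heading (rightward K c) u)"
        using d' d c path[of "d + d'"] by (intro inside_in_cell[OF B, of c] passable_below) auto
      then show ?thesis using adv[of d'] d' by simp
    qed
    show "\<not> inside (advance ((D - d) / cos \<theta>\<^sub>0) ?s)"
      using out d unfolding Y by (subst adv) auto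
  qed
  moreover have "advance ((D - d) / cos \<theta>\<^sub>0) ?s = ((fold_pos K (X + D), Y), layered K L B, heading (rightward K c) u)"
    using d unfolding Y by (subst adv) auto
  ultimately have st: "strikes st ((fold_pos K (X + D), Y), layered K L B, heading (rightward K c) u)" by simp
  show nv: "(fold_pos K (X + D), Y) \<notin> vertices K h (layered K L B)"
    using strikes_not_vertex[OF av st] .
  then have "fold_pos K (X + D) \<notin> {0, real K}" using corner by blast
  then have x: "0 < fold_pos K (X + D)" "fold_pos K (X + D) < real K"
    using fold_pos_bounds[OF K, of "X + D"] by auto
  have dir: "rightward K \<lfloor>X + D\<rfloor> = rightward K c"
  proof (cases "X + D = of_int c + 1")
    case True
    then have "\<lfloor>X + D\<rfloor> = c + 1" by simp
    then show ?thesis using fold_pos_at_wall[OF K, of c] x True by auto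
  next
    case False
    then have "\<lfloor>X + D\<rfloor> = c" using c by linarith
    then show ?thesis by simp
  qed
  have "reflect K h (layered K L B) (fold_pos K (X + D), Y) (heading (rightward K c) u) = heading (rightward K c) (\<not> u)"
  proof (rule reflect_at_floor_or_ceiling)
    show "0 < D * tan \<theta>\<^sub>0" using D trig_pos by simp
    fix t assume t: "0 < t" "t < D * tan \<theta>\<^sub>0"
    define t' where "t' = D - t / tan \<theta>\<^sub>0"
    have t': "0 < t'" "t' < D" using t trig_pos by (auto simp: t'_def pos_divide_less_eq)
    have "Y - sg u * t = y + sg u * (t' * tan \<theta>\<^sub>0)"
      using trig_pos unfolding Y t'_def by (simp add: algebra_simps)
    then have "- h < Y - sg u * t" "Y - sg u * t < real L" using path[OF t'] by auto
    then show "inside ((fold_pos K (X + D), Y - sg u * t), layered K L B, 0)"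
      using x by (auto simp: inside_layered[OF B] free_region_def)
  qed
  then show "returns st (mover (X + D) Y (remove_hit K (fold_pos K (X + D), Y) (layered K L B)) (\<not> u))"
    using strikes_returns[OF st] by (simp add: mover_def dir)
qed

text \<open>Bounce off a brick of row \<open>L\<close> and return to the floor. The hit point is not a vertex, hence not
above an integer, so exactly one brick is touched, and the way down is below level \<open>L\<close>.\<close>

lemma returns_after_ceiling:
  assumes B: "B \<subseteq> {..<K}" and av: "avoids_vertices st"
    and y: "- h \<le> y" "y < real L"
    and re: "reaches st (mover X y (layered K L B) True)"
    and X1: "X1 = X + (real L - y) / tan \<theta>\<^sub>0" and k: "cell K \<lfloor>X1\<rfloor> \<in> B"
    and X2: "X2 = X1 + (real L + h) / tan \<theta>\<^sub>0"
  shows "returns st (mover X2 (- h) (layered K L (B - {cell K \<lfloor>X1\<rfloor>})) True)"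
    and "0 < fold_pos K X2 \<and> fold_pos K X2 < real K"
proof -
  let ?k = "cell K \<lfloor>X1\<rfloor>"
  have fX1: "real ?k \<le> fold_pos K X1" "fold_pos K X1 \<le> real ?k + 1"
    by (rule fold_pos_between[OF K]; linarith)+
  have kK: "?k < K" by (rule cell_less[OF K])
  have mono: "t * tan \<theta>\<^sub>0 < D * tan \<theta>\<^sub>0" if "t < D" for t D using that trig_pos by simp
  have hit: "(fold_pos K X1, real L) \<notin> vertices K h (layered K L B)"
    "returns st (mover X1 (real L) (remove_hit K (fold_pos K X1, real L) (layered K L B)) (\<not> True))"
  proof -
    have D: "0 < (real L - y) / tan \<theta>\<^sub>0" using y trig_pos by simp
    have path: "- h < y + sg True * (t * tan \<theta>\<^sub>0) \<and> y + sg True * (t * tan \<theta>\<^sub>0) < real L"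
      if t: "0 < t" "t < (real L - y) / tan \<theta>\<^sub>0" for t
    proof -
      have "0 < t * tan \<theta>\<^sub>0" using t trig_pos by simp
      moreover have "t * tan \<theta>\<^sub>0 < real L - y" using t trig_pos by (simp add: pos_less_divide_eq)
      ultimately show ?thesis using y by simp
    qed
    have Y: "real L = y + sg True * ((real L - y) / tan \<theta>\<^sub>0 * tan \<theta>\<^sub>0)" using trig_pos by simp
    have out: "\<not> inside ((fold_pos K X1, real L), layered K L B, \<theta>)" for \<theta>
      using fX1 by (intro not_inside_brick[OF B k]) auto
    have corner: "(fold_pos K X1, real L) \<in> vertices K h (layered K L B)" if "fold_pos K X1 \<in> {0, real K}"
    proof (rule vertices_layered_brick[OF B k])
      show "fold_pos K X1 = real ?k \<or> fold_pos K X1 = real ?k + 1"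
        using that fX1 kK by auto
    qed
    show "(fold_pos K X1, real L) \<notin> vertices K h (layered K L B)"
      "returns st (mover X1 (real L) (remove_hit K (fold_pos K X1, real L) (layered K L B)) (\<not> True))"
      using returns_at_floor_or_ceiling[OF B av D re path Y] out corner unfolding X1 by blast+
  qed
  have "X1 \<noteq> of_int \<lfloor>X1\<rfloor>"
  proof
    assume "X1 = of_int \<lfloor>X1\<rfloor>"
    then have "fold_pos K X1 = real ?k \<or> fold_pos K X1 = real ?k + 1"
      using fold_pos_in_cell[OF K, of "\<lfloor>X1\<rfloor>" X1] by (auto split: if_splits)
    then show False using hit(1) vertices_layered_brick[OF B k] by blast
  qed
  then have i: "real ?k < fold_pos K X1" "fold_pos K X1 < real ?k + 1"
    using fold_pos_interior[OF K, of "\<lfloor>X1\<rfloor>" X1] floor_correct[of X1] by auto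
  have "k' = ?k" if "real k' \<le> fold_pos K X1" "fold_pos K X1 \<le> real k' + 1" for k'
    using i that by linarith
  then have "B - {k'. (fold_pos K X1, real L) \<in> brick (k', L)} = B - {?k}"
    using i by (auto simp: mem_brick_iff)
  then have "returns st (mover X1 (real L) (layered K L (B - {?k})) False)"
    using hit(2) remove_hit_layered[OF B, of "(fold_pos K X1, real L)" L] by simp
  then have re1: "reaches st (mover X1 (real L) (layered K L (B - {?k})) False)"
    by (rule returns_reaches) (simp add: mover_def not_launching_down)
  have B': "B - {?k} \<subseteq> {..<K}" using B by blast
  have D: "0 < (real L + h) / tan \<theta>\<^sub>0" using y trig_pos by simp
  have path: "- h < real L + sg False * (t * tan \<theta>\<^sub>0) \<and> real L + sg False * (t * tan \<theta>\<^sub>0) < real L"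
    if t: "0 < t" "t < (real L + h) / tan \<theta>\<^sub>0" for t
  proof -
    have "0 < t * tan \<theta>\<^sub>0" using t trig_pos by simp
    moreover have "t * tan \<theta>\<^sub>0 < real L + h" using t trig_pos by (simp add: pos_less_divide_eq)
    ultimately show ?thesis by simp
  qed
  have Y: "- h = real L + sg False * ((real L + h) / tan \<theta>\<^sub>0 * tan \<theta>\<^sub>0)" using trig_pos by simp
  have out: "\<not> inside ((fold_pos K X2, - h), layered K L (B - {?k}), \<theta>)" for \<theta>
    using inside_imp_above[OF _ B'] by blast
  have corner: "(x, - h) \<in> vertices K h \<eta>" if "x \<in> {0, real K}" for x \<eta>
    using that by (auto simp: vertices_def Delta_vertices_def)
  note ret = returns_at_floor_or_ceiling[OF B' av D re1 path Y, folded X2, OF _ _ out corner]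
  have "(fold_pos K X2, - h) \<notin> brick (k', L)" for k'
    using y by (simp add: mem_brick_iff)
  then have "remove_hit K (fold_pos K X2, - h) (layered K L (B - {?k})) = layered K L (B - {?k})"
    using remove_hit_layered[OF B', of "(fold_pos K X2, - h)" L] y by simp
  then show "returns st (mover X2 (- h) (layered K L (B - {?k})) True)"
    using ret(2) by simp
  have "fold_pos K X2 \<notin> {0, real K}" using ret(1) corner by blast
  then show "0 < fold_pos K X2 \<and> fold_pos K X2 < real K"
    using fold_pos_bounds[OF K, of X2] by auto
qed

text \<open>Entering row \<open>L\<close> through a missing brick. If level \<open>L\<close> is reached exactly at the end of a cell \<open>c\<close>, a
brick present in that cell would be hit at one of its vertices, so the cell just left is missing as well and
the segment that ends at level \<open>L\<close> stays in the interior.\<close>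

lemma reaches_gap:
  assumes B: "B \<subseteq> {..<K}" and av: "avoids_vertices st"
    and y: "- h \<le> y" "y \<le> real L"
    and re: "reaches st (mover X y (layered K L B) True)"
    and X1: "X1 = X + (real L - y) / tan \<theta>\<^sub>0" and k: "cell K \<lfloor>X1\<rfloor> \<notin> B"
  shows "reaches st (mover X1 (real L) (layered K L B) True)"
proof (cases "y = real L")
  case True
  then show ?thesis using re X1 by simp
next
  case False
  define D where "D = (real L - y) / tan \<theta>\<^sub>0"
  have D: "0 < D" "y + D * tan \<theta>\<^sub>0 = real L" "X1 = X + D" using False y trig_pos X1 by (auto simp: D_def)
  define c where "c = \<lceil>X1\<rceil> - 1"
  have c: "of_int c < X + D" "X + D \<le> of_int c + 1" unfolding c_def D(3)[symmetric] by linarith+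
  define d where "d = max 0 (of_int c - X)"
  have d: "0 \<le> d" "d < D" "of_int c \<le> X + d" using c D by (auto simp: d_def)
  have path: "- h < y + t * tan \<theta>\<^sub>0 \<and> y + t * tan \<theta>\<^sub>0 < real L" if t: "0 < t" "t < D" for t
  proof -
    have "0 < t * tan \<theta>\<^sub>0" "t * tan \<theta>\<^sub>0 < D * tan \<theta>\<^sub>0" using t trig_pos by simp_all
    then show ?thesis using y D by linarith
  qed
  let ?s = "mover (X + d) (y + sg True * (d * tan \<theta>\<^sub>0)) (layered K L B) True"
  have re': "reaches st ?s"
    using path d by (intro reaches_fly[OF B d(1) re]) auto
  have adv: "advance (t / cos \<theta>\<^sub>0) ?s = ((fold_pos K (X + d + t), y + (d + t) * tan \<theta>\<^sub>0), layered K L B, heading (rightward K c) True)"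
    if "0 \<le> t" "t \<le> D - d" for t
    using that c d advance_mover[of c "X + d" t] by (simp add: algebra_simps)
  have gap: "cell K c \<notin> B"
  proof
    assume kB: "cell K c \<in> B"
    \<comment> \<open>otherwise the cell being crossed at level \<open>L\<close> would be the empty cell \<open>\<lfloor>X1\<rfloor>\<close>\<close>
    have eq: "X + D = of_int c + 1"
    proof (rule ccontr)
      assume "X + D \<noteq> of_int c + 1"
      then have "\<lfloor>X1\<rfloor> = c" using c D by linarith
      then show False using kB k by simp
    qed
    have f: "fold_pos K (X + D) = real (cell K c) \<or> fold_pos K (X + D) = real (cell K c) + 1"
      using fold_pos_in_cell[OF K, of c "of_int c + 1"] unfolding eq by simp
    have end_adv: "advance ((D - d) / cos \<theta>\<^sub>0) ?s = ((fold_pos K (X + D), real L), layered K L B, heading (rightward K c) True)"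
      using d D(2) by (subst adv) auto
    have "strikes st (advance ((D - d) / cos \<theta>\<^sub>0) ?s)"
    proof (rule reaches_strikes[OF re'])
      show "0 < (D - d) / cos \<theta>\<^sub>0" using d trig_pos by simp
      show "inside (advance t ?s)" if t: "0 < t" "t < (D - d) / cos \<theta>\<^sub>0" for t
      proof -
        define d' where "d' = t * cos \<theta>\<^sub>0"
        have d': "0 < d'" "d' < D - d" "t = d' / cos \<theta>\<^sub>0"
          using t trig_pos by (auto simp: d'_def pos_less_divide_eq)
        have "inside ((fold_pos K (X + d + d'), y + (d + d') * tan \<theta>\<^sub>0), layered K L B, heading (rightward K c) True)"
          using d' d c path[of "d + d'"] by (intro inside_in_cell[OF B, of c] passable_below) auto
        then show ?thesis using adv[of d'] d' by simp
      qed
      show "\<not> inside (advance ((D - d) / cos \<theta>\<^sub>0) ?s)"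
        unfolding end_adv using f by (intro not_inside_brick[OF B kB]) auto
    qed
    then have "(fold_pos K (X + D), real L) \<notin> vertices K h (layered K L B)"
      unfolding end_adv by (rule strikes_not_vertex[OF av])
    then show False using vertices_layered_brick[OF B kB f] by blast
  qed
  have "reaches st (mover (X + d + (D - d)) (y + sg True * (d * tan \<theta>\<^sub>0) + sg True * ((D - d) * tan \<theta>\<^sub>0)) (layered K L B) True)"
  proof (rule reaches_cell_move[OF B d(3) _ _ _ re'])
    show "passable L B c (y + sg True * (d * tan \<theta>\<^sub>0) + sg True * (t * tan \<theta>\<^sub>0))" if t: "0 < t" "t \<le> D - d" for t
    proof (cases "t = D - d")
      case True
      have "y + sg True * (d * tan \<theta>\<^sub>0) + sg True * (t * tan \<theta>\<^sub>0) = real L"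
        using D(2) unfolding True by (simp add: algebra_simps)
      then show ?thesis using gap y False by (simp add: passable_def)
    next
      case neq: False
      then show ?thesis using path[of "d + t"] t d by (intro passable_below) (auto simp: algebra_simps)
    qed
    show "passable L B \<lfloor>X + d + (D - d)\<rfloor> (y + sg True * (d * tan \<theta>\<^sub>0) + sg True * ((D - d) * tan \<theta>\<^sub>0))"
      using D k y False by (simp add: passable_def algebra_simps)
  qed (use c d in auto)
  then show ?thesis using D by (simp add: algebra_simps)
qed

lemma admissible_mover:
  assumes B: "B \<subseteq> {..<K}" and L: "- h < real L" and x: "0 < fold_pos K X" "fold_pos K X < real K"
  shows "admissible K h (mover X (- h) (layered K L B) True)"
proof -
  let ?x = "fold_pos K X" and ?r = "rightward K \<lfloor>X\<rfloor>"
  have ev: "\<forall>\<^sub>F s in at_right 0. (?x, - h) + s *\<^sub>R velocity (heading ?r True) \<in> interior (domain K h (layered K L B))"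
    unfolding eventually_at_right_field
  proof (intro exI[of _ "Min {?x, real K - ?x, real L + h}"] conjI allI impI)
    show "0 < Min {?x, real K - ?x, real L + h}" using x L by simp
    fix s assume s: "0 < s" "s < Min {?x, real K - ?x, real L + h}"
    have s': "s < ?x" "s < real K - ?x" "s < real L + h" using s by simp_all
    have le: "s * cos \<theta>\<^sub>0 \<le> s * 1" "s * sin \<theta>\<^sub>0 \<le> s * 1" using s by (intro mult_left_mono; simp)+
    have pos: "0 < s * cos \<theta>\<^sub>0" "0 < s * sin \<theta>\<^sub>0" using s trig_pos by simp_all
    have "s * (sg ?r * cos \<theta>\<^sub>0) = s * cos \<theta>\<^sub>0 \<or> s * (sg ?r * cos \<theta>\<^sub>0) = - (s * cos \<theta>\<^sub>0)"
      by (simp add: sg_def)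
    then have "0 < ?x + s * (sg ?r * cos \<theta>\<^sub>0) \<and> ?x + s * (sg ?r * cos \<theta>\<^sub>0) < real K"
      using s' le pos by linarith
    moreover have "- h < - h + s * sin \<theta>\<^sub>0 \<and> - h + s * sin \<theta>\<^sub>0 < real L"
      using s' le pos by linarith
    ultimately have "(?x + s * (sg ?r * cos \<theta>\<^sub>0), - h + s * sin \<theta>\<^sub>0) \<in> free_region K h L B"
      unfolding free_region_def by auto
    then show "(?x, - h) + s *\<^sub>R velocity (heading ?r True) \<in> interior (domain K h (layered K L B))"
      by (simp add: velocity_heading interior_domain_layered[OF K B])
  qed
  moreover have "(?x, - h) \<in> domain K h (layered K L B)" using ev by (rule domain_if_approached)
  ultimately show ?thesis
    using heading_bounds by (simp add: admissible_def mover_def states_def well_filled_layered)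
qed

text \<open>If the floor is at level \<open>L\<close> (that is, \<open>h = 0\<close> and \<open>L = 0\<close>), the particle starts inside the row, and it
cannot start into a brick.\<close>

lemma admissible_at_level_imp_gap:
  assumes B: "B \<subseteq> {..<K}" and L: "real L = - h"
    and adm: "admissible K h (mover X (- h) (layered K L B) True)"
  shows "cell K \<lfloor>X\<rfloor> \<notin> B"
proof
  assume k: "cell K \<lfloor>X\<rfloor> \<in> B"
  have X: "of_int \<lfloor>X\<rfloor> \<le> X" "X < of_int \<lfloor>X\<rfloor> + 1" by linarith+
  obtain b where b: "0 < b" "\<And>s. 0 < s \<Longrightarrow> s < b \<Longrightarrow> inside (advance s (mover X (- h) (layered K L B) True))"
    using adm unfolding admissible_def mover_def eventually_at_right_field inside_def by auto
  define d where "d = min (b / 2 * cos \<theta>\<^sub>0) (of_int \<lfloor>X\<rfloor> + 1 - X)"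
  have d: "0 < d" "X + d \<le> of_int \<lfloor>X\<rfloor> + 1" using b X trig_pos by (auto simp: d_def)
  have "0 < b * cos \<theta>\<^sub>0" using b trig_pos by simp
  moreover have "d \<le> b / 2 * cos \<theta>\<^sub>0" unfolding d_def by (rule min.cobounded1)
  ultimately have "d < b * cos \<theta>\<^sub>0" by simp
  then have "inside (advance (d / cos \<theta>\<^sub>0) (mover X (- h) (layered K L B) True))"
    using d trig_pos by (intro b) (auto simp: pos_divide_less_eq)
  then have "inside ((fold_pos K (X + d), - h + d * tan \<theta>\<^sub>0), layered K L B, heading (rightward K \<lfloor>X\<rfloor>) True)"
    using d by (subst (asm) advance_mover[OF X]) auto
  moreover have "\<not> inside ((fold_pos K (X + d), - h + d * tan \<theta>\<^sub>0), layered K L B, heading (rightward K \<lfloor>X\<rfloor>) True)"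
  proof (rule not_inside_brick[OF B k])
    show "real (cell K \<lfloor>X\<rfloor>) \<le> fold_pos K (X + d)" "fold_pos K (X + d) \<le> real (cell K \<lfloor>X\<rfloor>) + 1"
      using d X by (intro fold_pos_between[OF K]; linarith)+
    show "real L \<le> - h + d * tan \<theta>\<^sub>0" using L d trig_pos by simp
  qed
  ultimately show False by blast
qed

section \<open>The first return to the floor\<close>

lemma inside_not_launching: "inside st \<Longrightarrow> \<not> launching st"
proof
  assume i: "inside st" and l: "launching st"
  obtain x y \<eta> \<theta> where st: "st = ((x, y), \<eta>, \<theta>)" by (metis prod.exhaust)
  have "(x, y) \<in> interior (Delta K h)"
    using i interior_mono[OF domain_subset_Delta] unfolding st inside_def by blast
  then show False using l by (auto simp: launching_def st interior_Delta)
qed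

lemma Bstar_iff: "st \<in> Bstar K h \<theta>\<^sub>0 \<longleftrightarrow> regular K h st \<and> launching st"
  by (cases st) (auto simp: Bstar_def launching_def)

text \<open>Strictly between departure and return the trajectory is not in \<open>Bstar\<close>: inside the legs it
is in the interior of the strip, and at the intermediate collisions this is part of \<open>returns\<close>. That the leg
after the return is clear makes the flow at the return time equal to the state after the collision.\<close>

lemma first_return_eq:
  assumes ret: "returns st st'" and next_leg: "clear_leg st'" and B': "st' \<in> Bstar K h \<theta>\<^sub>0"
  shows "first_return K h \<theta>\<^sub>0 st = st'"
proof -
  obtain m where m: "st' = collision_state K h st (Suc m)"
    "\<forall>j\<le>m. clear_leg (collision_state K h st j)"
    "\<forall>j\<in>{0<..m}. \<not> launching (collision_state K h st j)"
    using ret unfolding returns_def by blast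
  define ct where "ct = collision_time K h st"
  have ct_Suc: "ct (Suc n) = ct n + hit_time K h (collision_state K h st n)" for n
    by (simp add: ct_def collision_time_def)
  have ct0: "ct 0 = 0" by (simp add: ct_def collision_time_def)
  have pos: "0 < hit_time K h (collision_state K h st j)" if "j \<le> Suc m" for j
    using m(1,2) next_leg that by (cases "j = Suc m") (auto simp: clear_leg_def)
  have mono: "ct i \<le> ct j" if "i \<le> j" "j \<le> Suc m" for i j
    using that
  proof (induction j rule: dec_induct)
    case (step n)
    then show ?case using pos[of n] by (simp add: ct_Suc)
  qed simp
  have leg: "flow K h t st = advance (t - ct n) (collision_state K h st n)"
    if n: "n \<le> Suc m" "ct n \<le> t" "t < ct (Suc n)" for n t
  proof -
    have "(LEAST n. t < collision_time K h st (Suc n)) = n"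
    proof (rule Least_equality)
      show "t < collision_time K h st (Suc n)" using n by (simp add: ct_def)
      fix i assume i: "t < collision_time K h st (Suc i)"
      show "n \<le> i"
      proof (rule ccontr)
        assume "\<not> n \<le> i"
        then have "ct (Suc i) \<le> ct n" using n by (intro mono) auto
        then show False using i n by (simp add: ct_def)
      qed
    qed
    then show ?thesis by (simp add: flow_def Let_def ct_def)
  qed
  define T where "T = ct (Suc m)"
  have flowT: "flow K h T st = st'"
    using leg[of "Suc m" T] pos[of "Suc m"] by (simp add: T_def ct_Suc[of "Suc m"] m(1))
  have T0: "0 < T" using mono[of 0 m] pos[of m] by (simp add: T_def ct_Suc ct0)
  have "return_time K h \<theta>\<^sub>0 st = T"
    unfolding return_time_def
  proof (rule cInf_eq_minimum)
    show "T \<in> {t. 0 < t \<and> flow K h t st \<in> Bstar K h \<theta>\<^sub>0}" using T0 flowT B' by simp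
    fix t assume t: "t \<in> {t. 0 < t \<and> flow K h t st \<in> Bstar K h \<theta>\<^sub>0}"
    show "T \<le> t"
    proof (rule ccontr)
      assume "\<not> T \<le> t"
      then have ex: "t < ct (Suc m)" by (simp add: T_def)
      define n where "n = (LEAST n. t < ct (Suc n))"
      have n: "t < ct (Suc n)" "n \<le> m"
        unfolding n_def using ex by (rule LeastI, rule Least_le)
      have "ct n \<le> t"
      proof (cases n)
        case 0
        then show ?thesis using t by (simp add: ct0)
      next
        case (Suc i)
        then have "\<not> t < ct (Suc i)" using not_less_Least[of i "\<lambda>n. t < ct (Suc n)"] by (simp add: n_def)
        then show ?thesis using Suc by simp
      qed
      then have fl: "flow K h t st = advance (t - ct n) (collision_state K h st n)"
        using n by (intro leg) auto
      have "\<not> launching (flow K h t st)"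
      proof (cases "t = ct n")
        case True
        have "n \<noteq> 0"
        proof
          assume "n = 0"
          then have "t = 0" using True by (simp add: ct0)
          then show False using t by simp
        qed
        then show ?thesis using m(3) n fl True by simp
      next
        case False
        then have "inside (advance (t - ct n) (collision_state K h st n))"
          using m(2) n \<open>ct n \<le> t\<close> unfolding clear_leg_def by (simp add: ct_Suc)
        then show ?thesis using fl inside_not_launching by simp
      qed
      then show False using t by (simp add: Bstar_iff)
    qed
  qed
  then show ?thesis using flowT by (simp add: first_return_def)
qed

lemma returns_clear_leg: "returns st st' \<Longrightarrow> clear_leg st"
  unfolding returns_def by (metis collision_state_0 le0)

lemma returns_avoids_vertices: "returns st st' \<Longrightarrow> avoids_vertices st \<Longrightarrow> avoids_vertices st'"
  unfolding returns_def using avoids_vertices_collision_state by blast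

text \<open>If the cell of \<open>U\<close> is empty, \<open>V\<close> is the unfolded coordinate at level \<open>L + 1\<close>: after
\<open>K (K - 1)\<close> steps the particle is at an integer, at horizontal distance \<open>K (K - 1) - frac U\<close> from its entry
point, and the row is empty, so the rest of the climb is a free flight under the full row \<open>L + 1\<close>.\<close>

lemma returns_from_floor:
  assumes B: "B \<subseteq> {..<K}" "B \<noteq> {}" and steep: "real (K * (K - 1)) * tan \<theta>\<^sub>0 < 1"
    and adm: "admissible K h (mover X (- h) (layered K L B) True)"
    and av: "avoids_vertices (mover X (- h) (layered K L B) True)"
    and U: "U = X + (real L + h) / tan \<theta>\<^sub>0"
  defines "V \<equiv> of_int (snd (passage K B \<lfloor>U\<rfloor>)) - real (K * (K - 1)) + frac U + 1 / tan \<theta>\<^sub>0"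
  defines "st' \<equiv> if cell K \<lfloor>U\<rfloor> \<in> B
    then mover (U + (real L + h) / tan \<theta>\<^sub>0) (- h) (layered K L (B - {cell K \<lfloor>U\<rfloor>})) True
    else mover (V + (real L + 1 + h) / tan \<theta>\<^sub>0) (- h) (layered K (Suc L) ({..<K} - {cell K \<lfloor>V\<rfloor>})) True"
  shows "returns (mover X (- h) (layered K L B) True) st'" "admissible K h st'"
proof -
  let ?st = "mover X (- h) (layered K L B) True" and ?k = "cell K \<lfloor>U\<rfloor>"
  have re: "reaches ?st ?st" by (rule reaches_refl)
  have hL: "- h \<le> real L" using h by (meson neg_le_0_iff_le of_nat_0_le_iff order_trans)
  have "returns ?st st' \<and> admissible K h st'"
  proof (cases "?k \<in> B")
    case True
    then have "- h < real L" using admissible_at_level_imp_gap[OF B(1) _ adm] hL U by (cases "real L = - h") auto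
    moreover from returns_after_ceiling[OF B(1) av order_refl this re _ True, of "U + (real L + h) / tan \<theta>\<^sub>0"]
    have "returns ?st (mover (U + (real L + h) / tan \<theta>\<^sub>0) (- h) (layered K L (B - {?k})) True)"
      "0 < fold_pos K (U + (real L + h) / tan \<theta>\<^sub>0) \<and> fold_pos K (U + (real L + h) / tan \<theta>\<^sub>0) < real K"
      using U by simp_all
    ultimately show ?thesis
      using True B admissible_mover[of "B - {?k}" L] by (auto simp: st'_def)
  next
    case gap: False
    obtain k where "k \<in> B" "k < K" using B by blast
    then have K2: "2 \<le> K" using gap cell_less[OF K, of "\<lfloor>U\<rfloor>"] by (cases "K = 1") (auto simp: less_Suc_eq)
    define N where "N = K * (K - 1)"
    have N1: "1 \<le> N" using K2 by (simp add: N_def)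
    obtain c where c: "(walk_step K ^^ N) (B, \<lfloor>U\<rfloor>) = ({}, c)"
      using walk_clears_row[OF K B(1) gap] unfolding N_def by (metis prod.collapse)
    have re1: "reaches ?st (mover U (real L) (layered K L B) True)"
      using U gap by (intro reaches_gap[OF B(1) av order_refl hL re]) auto
    have "(real N - frac U) * tan \<theta>\<^sub>0 \<le> real N * tan \<theta>\<^sub>0"
      using trig_pos by (intro mult_right_mono) auto
    then have lt: "(real N - frac U) * tan \<theta>\<^sub>0 < 1" using steep by (simp add: N_def)
    define y where "y = real L + (real N - frac U) * tan \<theta>\<^sub>0"
    have "0 \<le> (real N - frac U) * tan \<theta>\<^sub>0"
      using N1 frac_lt_1[of U] trig_pos by (intro mult_nonneg_nonneg) auto
    then have y: "- h \<le> y" "y < real (Suc L)" using hL lt by (auto simp: y_def)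
    have "reaches ?st (mover (of_int c) y (layered K L {}) True)"
      unfolding y_def using reaches_walk[OF B(1) gap re1 N1 lt c] .
    then have re2: "reaches ?st (mover (of_int c) y (layered K (Suc L) {..<K}) True)"
      by (simp add: layered_empty)
    have V: "V = of_int c + (real (Suc L) - y) / tan \<theta>\<^sub>0"
    proof -
      have "(real (Suc L) - y) / tan \<theta>\<^sub>0 = (1 - (real N - frac U) * tan \<theta>\<^sub>0) / tan \<theta>\<^sub>0"
        by (simp add: y_def)
      also have "\<dots> = 1 / tan \<theta>\<^sub>0 - (real N - frac U)"
        using trig_pos by (simp add: diff_divide_distrib)
      finally show ?thesis using c by (simp add: V_def passage_def N_def)
    qed
    have kV: "cell K \<lfloor>V\<rfloor> \<in> {..<K}" using cell_less[OF K] by simp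
    have "returns ?st st'" "0 < fold_pos K (V + (real L + 1 + h) / tan \<theta>\<^sub>0) \<and> fold_pos K (V + (real L + 1 + h) / tan \<theta>\<^sub>0) < real K"
      using returns_after_ceiling[OF order_refl av y re2 V kV, of "V + (real L + 1 + h) / tan \<theta>\<^sub>0"] gap
      by (simp_all add: st'_def add.commute)
    moreover have "- h < real (Suc L)" using hL by simp
    ultimately show ?thesis
      using gap admissible_mover[of "{..<K} - {cell K \<lfloor>V\<rfloor>}" "Suc L"] by (auto simp: st'_def)
  qed
  then show "returns ?st st'" "admissible K h st'" by auto
qed

text \<open>The state reached on return is again a launching state over a balanced configuration, so
\<open>returns_from_floor\<close> applies to it too and supplies the clear leg that \<open>first_return_eq\<close> asks for.\<close>

lemma first_return_from_floor:
  assumes B: "B \<subseteq> {..<K}" "B \<noteq> {}" and steep: "real (K * (K - 1)) * tan \<theta>\<^sub>0 < 1"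
    and st: "mover X (- h) (layered K L B) True \<in> Bstar K h \<theta>\<^sub>0"
    and U: "U = X + (real L + h) / tan \<theta>\<^sub>0"
  defines "V \<equiv> of_int (snd (passage K B \<lfloor>U\<rfloor>)) - real (K * (K - 1)) + frac U + 1 / tan \<theta>\<^sub>0"
  shows "first_return K h \<theta>\<^sub>0 (mover X (- h) (layered K L B) True) = (if cell K \<lfloor>U\<rfloor> \<in> B
    then mover (U + (real L + h) / tan \<theta>\<^sub>0) (- h) (layered K L (B - {cell K \<lfloor>U\<rfloor>})) True
    else mover (V + (real L + 1 + h) / tan \<theta>\<^sub>0) (- h) (layered K (Suc L) ({..<K} - {cell K \<lfloor>V\<rfloor>})) True)"
    (is "_ = ?st'")
proof (rule first_return_eq)
  let ?st = "mover X (- h) (layered K L B) True"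
  have reg: "admissible K h ?st" "avoids_vertices ?st" using st by (auto simp: Bstar_iff regular_iff)
  note ret = returns_from_floor[OF B steep reg U, folded V_def]
  show "returns ?st ?st'" by (rule ret)
  have av': "avoids_vertices ?st'" using returns_avoids_vertices[OF ret(1) reg(2)] .
  obtain X' L' B' where 1: "?st' = mover X' (- h) (layered K L' B') True" "B' \<subseteq> {..<K}" "B' \<noteq> {}"
  proof (cases "cell K \<lfloor>U\<rfloor> \<in> B")
    case True
    show ?thesis
    proof (cases "B - {cell K \<lfloor>U\<rfloor>} = {}")
      case empty: True
      show ?thesis
        using True cell_less[OF K] by (intro that[of "U + (real L + h) / tan \<theta>\<^sub>0" "Suc L" "{..<K}"])
          (auto simp: empty layered_empty)
    next
      case False
      then show ?thesis using True B by (intro that[of _ L "B - {cell K \<lfloor>U\<rfloor>}"]) auto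
    qed
  next
    case False
    obtain k where "k \<in> B" "k < K" using B by blast
    then have K2: "2 \<le> K" using False cell_less[OF K, of "\<lfloor>U\<rfloor>"] by (cases "K = 1") (auto simp: less_Suc_eq)
    have "{..<K} - {cell K \<lfloor>V\<rfloor>} \<noteq> {}"
    proof
      assume "{..<K} - {cell K \<lfloor>V\<rfloor>} = {}"
      then have "card {..<K} \<le> card {cell K \<lfloor>V\<rfloor>}" by (intro card_mono) auto
      then show False using K2 by simp
    qed
    then show ?thesis using False by (intro that[of _ "Suc L" "{..<K} - {cell K \<lfloor>V\<rfloor>}"]) auto
  qed
  have "launching ?st'" unfolding 1(1) by (simp add: mover_def launching_def heading_def)
  then show "?st' \<in> Bstar K h \<theta>\<^sub>0" using av' ret(2) by (simp only: Bstar_iff regular_iff)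
  show "clear_leg ?st'"
    using returns_clear_leg returns_from_floor(1)[OF 1(2,3) steep _ _ refl] ret(2) av' unfolding 1(1) by blast
qed

end

section \<open>The factor map\<close>

lemma frac_eqI: "a - b \<in> \<int> \<Longrightarrow> frac a = frac (b :: real)"
proof -
  assume "a - b \<in> \<int>"
  then obtain n where "a - b = of_int n" by (elim Ints_cases)
  then have "a = b + of_int n" by simp
  then show ?thesis by (simp add: frac_def)
qed

lemma frac_add_left: "frac (frac a + b) = frac (a + b :: real)"
  by (rule frac_eqI) (simp add: frac_def)

definition row :: "nat \<Rightarrow> nat set \<Rightarrow> nat \<Rightarrow> nat" where
  "row K B = (\<lambda>k\<in>{..<K}. of_bool (k \<in> B))"

text \<open>The map \<open>row\<close> and this one identify \<open>Cstar\<close> with the nonempty sets of bricks.\<close>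

definition bricks :: "nat \<Rightarrow> (nat \<Rightarrow> nat) \<Rightarrow> nat set" where
  "bricks K \<xi> = {k. k < K \<and> \<xi> k = 1}"

lemma row_in_Cstar: "B \<subseteq> {..<K} \<Longrightarrow> B \<noteq> {} \<Longrightarrow> row K B \<in> Cstar K"
proof -
  assume B: "B \<subseteq> {..<K}" "B \<noteq> {}"
  then obtain k where "k \<in> B" "k < K" by blast
  then have "row K B k = 1" "(\<lambda>k\<in>{..<K}. 0 :: nat) k = 0" by (simp_all add: row_def)
  then have "row K B \<noteq> (\<lambda>k\<in>{..<K}. 0)" by auto
  then show ?thesis by (auto simp: Cstar_def row_def)
qed

lemma bricks_row: "B \<subseteq> {..<K} \<Longrightarrow> bricks K (row K B) = B"
  by (auto simp: bricks_def row_def)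

lemma row_bricks: "\<xi> \<in> Cstar K \<Longrightarrow> row K (bricks K \<xi>) = \<xi>"
  by (auto simp: bricks_def row_def Cstar_def PiE_iff extensional_def fun_eq_iff)

lemma bricks_Cstar: "\<xi> \<in> Cstar K \<Longrightarrow> bricks K \<xi> \<subseteq> {..<K} \<and> bricks K \<xi> \<noteq> {}"
proof
  assume \<xi>: "\<xi> \<in> Cstar K"
  show "bricks K \<xi> \<noteq> {}"
  proof
    assume "bricks K \<xi> = {}"
    then have "\<xi> = (\<lambda>k\<in>{..<K}. 0)" using row_bricks[OF \<xi>] by (simp add: row_def)
    then show False using \<xi> by (simp add: Cstar_def)
  qed
qed (auto simp: bricks_def)

context brick_billiard
begin

lemma Psi_mover:
  assumes "B \<subseteq> {..<K}" "B \<noteq> {}"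
  shows "Psi K h \<theta>\<^sub>0 (mover X y (layered K L B) True) =
    (frac (X / (2 * real K)), frac ((real L + h) / (2 * real K * tan \<theta>\<^sub>0)), row K B)"
proof -
  let ?c = "\<lfloor>X\<rfloor>" and ?q = "\<lfloor>X\<rfloor> div (2 * int K)"
  have K0: "0 < real K" using K by simp
  have c: "of_int ?c = 2 * real K * of_int ?q + of_int (?c mod (2 * int K))"
  proof -
    have "?c = 2 * int K * ?q + ?c mod (2 * int K)" by simp
    then have "(of_int ?c :: real) = of_int (2 * int K * ?q + ?c mod (2 * int K))" by metis
    also have "\<dots> = 2 * real K * of_int ?q + of_int (?c mod (2 * int K))"
      by (simp only: of_int_add of_int_mult of_int_of_nat_eq of_int_numeral)
    finally show ?thesis .
  qed
  have k: "real (cell K ?c) = (if rightward K ?c then of_int (?c mod (2 * int K)) else 2 * real K - 1 - of_int (?c mod (2 * int K)))"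
  proof -
    have "real (cell K ?c) = of_int (int (cell K ?c))" by simp
    then show ?thesis unfolding int_cell[OF K] by simp
  qed
  have "frac (if heading (rightward K ?c) True = \<theta>\<^sub>0 then fold_pos K X / (2 * real K) else 1 - fold_pos K X / (2 * real K))
    = frac (X / (2 * real K))"
  proof (cases "rightward K ?c")
    case True
    then have "fold_pos K X = X - 2 * real K * of_int ?q"
      using c k by (simp add: fold_pos_def frac_def)
    then have "fold_pos K X / (2 * real K) - X / (2 * real K) = - of_int ?q"
      using K0 by (simp add: field_simps)
    then show ?thesis using True by (intro frac_eqI) (simp add: heading_def)
  next
    case False
    then have "fold_pos K X = 2 * real K - (X - 2 * real K * of_int ?q)"
      using c k by (simp add: fold_pos_def frac_def)
    then have "fold_pos K X / (2 * real K) = 1 - (X / (2 * real K) - of_int ?q)"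
      using K0 by (simp add: diff_divide_distrib)
    then have "1 - fold_pos K X / (2 * real K) - X / (2 * real K) = - of_int ?q"
      by simp
    then show ?thesis using False \<theta>\<^sub>0 by (intro frac_eqI) (simp add: heading_def)
  qed
  moreover have "(\<lambda>k\<in>{..<K}. layered K L B (k, L)) = row K B"
    by (auto simp: row_def layered_def sites_def fun_eq_iff)
  ultimately show ?thesis
    by (simp only: mover_def Psi.simps fst_conv H_layered[OF assms])
qed

lemma Bstar_mover:
  assumes st: "((x, y), \<eta>, \<theta>) \<in> Bstar K h \<theta>\<^sub>0" and bal: "balanced K \<eta>"
  obtains X B where "((x, y), \<eta>, \<theta>) = mover X (- h) (layered K (H K \<eta>) B) True" "B \<subseteq> {..<K}" "B \<noteq> {}"
proof -
  have y: "y = - h" and \<theta>: "\<theta> \<in> {\<theta>\<^sub>0, pi - \<theta>\<^sub>0}" and adm: "admissible K h ((x, y), \<eta>, \<theta>)"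
    using st by (auto simp: Bstar_def regular_def)
  have wf: "well_filled K \<eta>" and dom: "(x, y) \<in> domain K h \<eta>"
    using adm by (auto simp: admissible_def states_def)
  have x: "0 \<le> x" "x \<le> real K" using dom domain_subset_Delta by (force simp: Delta_def)+
  obtain b where b: "0 < b" "\<forall>s>0. s < b \<longrightarrow> (x, y) + s *\<^sub>R velocity \<theta> \<in> interior (domain K h \<eta>)"
    using adm unfolding admissible_def eventually_at_right_field by auto
  define s where "s = b / 2"
  have s: "0 < s" "(x, y) + s *\<^sub>R velocity \<theta> \<in> interior (domain K h \<eta>)"
    using b by (auto simp: s_def)
  then have "(x, y) + s *\<^sub>R velocity \<theta> \<in> {0<..<real K} \<times> {- h<..}"
    using interior_mono[OF domain_subset_Delta] interior_Delta by blast
  then have "0 < x + s * cos \<theta>" "x + s * cos \<theta> < real K" by (auto simp: velocity_def)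
  moreover have "0 < s * cos \<theta>\<^sub>0" using s trig_pos by simp
  moreover have "cos \<theta> = (if \<theta> = \<theta>\<^sub>0 then cos \<theta>\<^sub>0 else - cos \<theta>\<^sub>0)" using \<theta> by (auto simp: cos_diff)
  ultimately have dir: "(\<theta> = \<theta>\<^sub>0 \<and> x < real K) \<or> (\<theta> \<noteq> \<theta>\<^sub>0 \<and> 0 < x)"
    by (auto split: if_splits)
  obtain B where B: "B \<subseteq> {..<K}" "B \<noteq> {}" "\<eta> = layered K (H K \<eta>) B"
    using balanced_imp_layered[OF K wf bal] .
  define X where "X = (if \<theta> = \<theta>\<^sub>0 then x else 2 * real K - x)"
  have "fold_pos K X = x \<and> heading (rightward K \<lfloor>X\<rfloor>) True = \<theta>"
  proof (cases "\<theta> = \<theta>\<^sub>0")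
    case True
    then have fl: "0 \<le> \<lfloor>X\<rfloor>" "\<lfloor>X\<rfloor> < int K" using dir x by (auto simp: X_def floor_less_iff)
    then have "\<lfloor>X\<rfloor> mod (2 * int K) = \<lfloor>X\<rfloor>" by (intro mod_pos_pos_trivial) auto
    then have "rightward K \<lfloor>X\<rfloor>" "int (cell K \<lfloor>X\<rfloor>) = \<lfloor>X\<rfloor>"
      using fl int_cell[OF K, of "\<lfloor>X\<rfloor>"] by (auto simp: rightward_def)
    moreover from this have "real (cell K \<lfloor>X\<rfloor>) = of_int \<lfloor>X\<rfloor>" by (metis of_int_of_nat_eq)
    ultimately show ?thesis using True by (simp add: fold_pos_def frac_def heading_def X_def)
  next
    case False
    then have fl: "int K \<le> \<lfloor>X\<rfloor>" "\<lfloor>X\<rfloor> < 2 * int K" using dir x by (auto simp: X_def floor_less_iff le_floor_iff)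
    have "0 \<le> \<lfloor>X\<rfloor>" using fl(1) by linarith
    then have "\<lfloor>X\<rfloor> mod (2 * int K) = \<lfloor>X\<rfloor>" using fl(2) by (rule mod_pos_pos_trivial)
    then have "\<not> rightward K \<lfloor>X\<rfloor>" "int (cell K \<lfloor>X\<rfloor>) = 2 * int K - 1 - \<lfloor>X\<rfloor>"
      using fl int_cell[OF K, of "\<lfloor>X\<rfloor>"] by (auto simp: rightward_def)
    moreover from this have "real (cell K \<lfloor>X\<rfloor>) = of_int (2 * int K - 1 - \<lfloor>X\<rfloor>)" by (metis of_int_of_nat_eq)
    ultimately show ?thesis using False \<theta> by (simp add: fold_pos_def frac_def heading_def X_def)
  qed
  then have "((x, y), \<eta>, \<theta>) = mover X (- h) (layered K (H K \<eta>) B) True"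
    using y B(3) by (simp add: mover_def)
  then show thesis using that B by blast
qed

end

text \<open>Bricks in the row, unfolded cell in which level \<open>L\<close> is reached, carry bit.\<close>

definition pieces :: "nat \<Rightarrow> (nat set \<times> int \<times> int) set" where
  "pieces K = {B. B \<subseteq> {..<K} \<and> B \<noteq> {}} \<times> {0..<2 * int K} \<times> {0, 1}"

text \<open>Here \<open>\<tau>\<close> is the horizontal distance covered while climbing one level. With \<open>u\<close> in a given cell, the
unit cell in which level \<open>L + 1\<close> is met is determined up to the carry from adding \<open>\<tau>\<close> to \<open>frac u\<close>.\<close>

definition piece_of :: "nat \<Rightarrow> real \<Rightarrow> real \<Rightarrow> real \<times> (nat \<Rightarrow> nat) \<Rightarrow> nat set \<times> int \<times> int" where
  "piece_of K \<tau> s = (\<lambda>(x, \<xi>). let u = 2 * real K * frac (x + s) in (bricks K \<xi>, \<lfloor>u\<rfloor>, \<lfloor>frac u + \<tau>\<rfloor> - \<lfloor>\<tau>\<rfloor>))"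

definition landing_cell :: "nat \<Rightarrow> real \<Rightarrow> nat set \<times> int \<times> int \<Rightarrow> nat" where
  "landing_cell K \<tau> = (\<lambda>(B, c, b). cell K (snd (passage K B c) - int (K * (K - 1)) + \<lfloor>\<tau>\<rfloor> + b))"

definition next_bricks :: "nat \<Rightarrow> real \<Rightarrow> nat set \<times> int \<times> int \<Rightarrow> nat set" where
  "next_bricks K \<tau> = (\<lambda>(B, c, b).
     if cell K c \<in> B then if B = {cell K c} then {..<K} else B - {cell K c}
     else {..<K} - {landing_cell K \<tau> (B, c, b)})"

definition climb :: "nat \<Rightarrow> nat set \<times> int \<times> int \<Rightarrow> nat" where
  "climb K = (\<lambda>(B, c, b). if cell K c \<in> B \<and> B \<noteq> {cell K c} then 0 else 1)"

text \<open>If the particle enters a gap, it climbs and descends one level more, which accounts for the term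
\<open>2 (\<tau> / 2 K)\<close>. The other term compares the cell \<open>c'\<close> in which the walk ends with the cell \<open>c + K (K - 1)\<close>
where an uninterrupted flight would have ended.\<close>

definition twist :: "nat \<Rightarrow> real \<Rightarrow> nat set \<times> int \<times> int \<Rightarrow> real" where
  "twist K \<tau> = (\<lambda>(B, c, b). if cell K c \<in> B then 0
     else frac (2 * (\<tau> / (2 * real K)) + (of_int (snd (passage K B c)) - of_int c - real (K * (K - 1))) / (2 * real K)))"

lemma finite_pieces: "finite (pieces K)"
proof -
  have "finite {B. B \<subseteq> {..<K} \<and> B \<noteq> {}}" by (rule finite_subset[of _ "Pow {..<K}"]) auto
  then show ?thesis by (simp add: pieces_def)
qed

lemma piece_of_in_pieces:
  assumes K: "1 \<le> K" and \<xi>: "\<xi> \<in> Cstar K"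
  shows "piece_of K \<tau> s (x, \<xi>) \<in> pieces K"
proof -
  let ?u = "2 * real K * frac (x + s)"
  have "0 \<le> ?u" "?u < 2 * real K" using K frac_lt_1[of "x + s"] by auto
  then have "0 \<le> \<lfloor>?u\<rfloor>" "\<lfloor>?u\<rfloor> < 2 * int K" by (simp_all add: floor_less_iff)
  moreover have "\<lfloor>frac ?u + \<tau>\<rfloor> - \<lfloor>\<tau>\<rfloor> \<in> {0, 1}"
  proof -
    have "\<lfloor>frac ?u + \<tau>\<rfloor> = \<lfloor>\<tau>\<rfloor> \<or> \<lfloor>frac ?u + \<tau>\<rfloor> = \<lfloor>\<tau>\<rfloor> + 1"
      using frac_ge_0[of ?u] frac_lt_1[of ?u] by linarith
    then show ?thesis by auto
  qed
  ultimately show ?thesis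
    using bricks_Cstar[OF \<xi>] by (simp add: piece_of_def pieces_def Let_def)
qed

lemma next_bricks_piece:
  assumes K: "1 \<le> K" and j: "j \<in> pieces K"
  shows "next_bricks K \<tau> j \<subseteq> {..<K} \<and> next_bricks K \<tau> j \<noteq> {}"
proof -
  obtain B c b where jB: "j = (B, c, b)" "B \<subseteq> {..<K}" "B \<noteq> {}" using j by (auto simp: pieces_def)
  show ?thesis
  proof (cases "cell K c \<in> B")
    case True
    have "{..<K} \<noteq> {}" using K cell_less[OF K] by (auto simp: lessThan_empty_iff)
    then show ?thesis using jB True by (auto simp: next_bricks_def)
  next
    case False
    obtain k where "k \<in> B" "k < K" using jB by blast
    then have "k \<in> {..<K}" "cell K c \<in> {..<K}" "k \<noteq> cell K c" using False cell_less[OF K] by auto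
    then have "{..<K} - {landing_cell K \<tau> j} \<noteq> {}" by (metis Diff_eq_empty_iff subsetD singletonD)
    then show ?thesis using jB False by (auto simp: next_bricks_def)
  qed
qed

text \<open>The unfolded coordinate is an increasing function of a lift of \<open>x\<close> to the line, and all conditions
bound it from above or below; because \<open>c\<close> is a fixed cell of the period \<open>[0, 2 K)\<close>, one lift suffices.\<close>

lemma arc_of_piece:
  assumes K: "1 \<le> K" and c: "0 \<le> c" "c < 2 * int K"
  shows "arc {x \<in> T1. \<lfloor>2 * real K * frac (x + s)\<rfloor> = c \<and> \<lfloor>frac (2 * real K * frac (x + s)) + \<tau>\<rfloor> - \<lfloor>\<tau>\<rfloor> = b}"
    (is "arc ?A")
proof -
  define g where "g t = 2 * real K * (t + s)" for t
  have mono: "g a \<le> g t" if "a \<le> t" for a t using that by (auto simp: g_def intro!: mult_left_mono)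
  define J where "J = {t. of_int c \<le> g t \<and> g t < of_int c + 1 \<and>
    of_int (\<lfloor>\<tau>\<rfloor> + b) \<le> g t - of_int c + \<tau> \<and> g t - of_int c + \<tau> < of_int (\<lfloor>\<tau>\<rfloor> + b) + 1}"
  have J: "t \<in> J \<longleftrightarrow> \<lfloor>g t\<rfloor> = c \<and> \<lfloor>frac (g t) + \<tau>\<rfloor> - \<lfloor>\<tau>\<rfloor> = b" for t
  proof -
    have "t \<in> J \<longleftrightarrow> \<lfloor>g t\<rfloor> = c \<and> \<lfloor>g t - of_int c + \<tau>\<rfloor> = \<lfloor>\<tau>\<rfloor> + b"
      unfolding J_def floor_eq_iff by blast
    then show ?thesis by (auto simp: frac_def)
  qed
  have "is_interval J"
    unfolding is_interval_1
  proof (intro ballI allI impI)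
    fix a t e assume "a \<in> J" "e \<in> J" "a \<le> t \<and> t \<le> e"
    moreover from this have "g a \<le> g t" "g t \<le> g e" by (simp_all add: mono)
    ultimately show "t \<in> J" unfolding J_def by auto
  qed
  moreover have "?A = frac ` J"
  proof (intro equalityI subsetI)
    fix x assume x: "x \<in> ?A"
    \<comment> \<open>the lift of \<open>x\<close> for which \<open>t + s\<close> lies in \<open>[0, 1)\<close>\<close>
    define t where "t = frac (x + s) - s"
    have "t \<in> J" using x by (simp add: J g_def t_def)
    moreover have "frac t = frac x" unfolding t_def by (rule frac_eqI) (simp add: frac_def)
    moreover have "frac x = x" using x by (simp add: T1_def frac_eq)
    ultimately show "x \<in> frac ` J" by force
  next
    fix x assume "x \<in> frac ` J"
    then obtain t where t: "t \<in> J" "x = frac t" by blast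
    have "of_int c \<le> 2 * real K * (t + s)" "2 * real K * (t + s) < of_int c + 1"
      using t(1) by (simp_all add: J_def g_def)
    moreover have "(of_int c :: real) + 1 \<le> 2 * real K" using c by linarith
    ultimately have "0 \<le> 2 * real K * (t + s)" "2 * real K * (t + s) < 2 * real K * 1" using c by linarith+
    then have "0 \<le> t + s" "t + s < 1" using K by (auto simp: zero_le_mult_iff)
    then have "frac (x + s) = t + s" unfolding t(2) frac_add_left by (simp add: frac_eq)
    then show "x \<in> ?A" using t(1) frac_lt_1[of t] by (simp add: J g_def T1_def t(2))
  qed
  ultimately show ?thesis unfolding arc_def by blast
qed

lemma interval_partition_pieces:
  assumes K: "1 \<le> K"
  shows "interval_partition K (pieces K) (\<lambda>j. {p \<in> T1 \<times> Cstar K. piece_of K \<tau> s p = j})"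
  unfolding interval_partition_def
proof (intro conjI ballI)
  fix j assume j: "j \<in> pieces K"
  obtain B c b where jB: "j = (B, c, b)" by (cases j)
  then have B: "B \<subseteq> {..<K}" "B \<noteq> {}" and c: "0 \<le> c" "c < 2 * int K"
    using j by (auto simp: pieces_def)
  let ?A = "{x \<in> T1. \<lfloor>2 * real K * frac (x + s)\<rfloor> = c \<and> \<lfloor>frac (2 * real K * frac (x + s)) + \<tau>\<rfloor> - \<lfloor>\<tau>\<rfloor> = b}"
  have "\<xi> \<in> Cstar K \<and> bricks K \<xi> = B \<longleftrightarrow> \<xi> = row K B" for \<xi>
    using row_bricks bricks_row[OF B(1)] row_in_Cstar[OF B] by metis
  then have "{p \<in> T1 \<times> Cstar K. piece_of K \<tau> s p = j} = ?A \<times> {row K B}"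
    by (auto simp: piece_of_def Let_def jB)
  moreover have "arc ?A" using arc_of_piece[OF K c] .
  ultimately show "interval_TC K {p \<in> T1 \<times> Cstar K. piece_of K \<tau> s p = j}"
    unfolding interval_TC_def using row_in_Cstar[OF B] by blast
next
  show "disjoint_family_on (\<lambda>j. {p \<in> T1 \<times> Cstar K. piece_of K \<tau> s p = j}) (pieces K)"
    by (auto simp: disjoint_family_on_def)
  show "(\<Union>j\<in>pieces K. {p \<in> T1 \<times> Cstar K. piece_of K \<tau> s p = j}) = T1 \<times> Cstar K"
    using piece_of_in_pieces[OF K] by fastforce
qed

context brick_billiard
begin

text \<open>The lift \<open>X\<close> of the initial position is chosen such that level \<open>L\<close> is met at \<open>U = 2 K frac (x + s)\<close>, a point of
\<open>[0, 2 K)\<close>; then the walk starts from the very cell recorded in the index of the piece.\<close>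

lemma Psi_first_return:
  assumes st: "(p, \<eta>, \<theta>) \<in> Bstar K h \<theta>\<^sub>0" and bal: "balanced K \<eta>"
    and steep: "real (K * (K - 1)) * tan \<theta>\<^sub>0 < 1" and \<tau>: "\<tau> = 1 / tan \<theta>\<^sub>0"
    and Psi: "Psi K h \<theta>\<^sub>0 (p, \<eta>, \<theta>) = (x, s, \<xi>)" and j: "j = piece_of K \<tau> s (x, \<xi>)"
  shows "Psi K h \<theta>\<^sub>0 (first_return K h \<theta>\<^sub>0 (p, \<eta>, \<theta>)) =
      (frac (x + 2 * s + twist K \<tau> j), frac (s + real (climb K j) * (\<tau> / (2 * real K))), row K (next_bricks K \<tau> j))"
    and "x \<in> T1" "s \<in> T1" "\<xi> \<in> Cstar K"
proof -
  define L where "L = H K \<eta>"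
  obtain y1 y2 where p: "p = (y1, y2)" by (cases p)
  obtain X0 B where B: "(p, \<eta>, \<theta>) = mover X0 (- h) (layered K L B) True" "B \<subseteq> {..<K}" "B \<noteq> {}"
    using Bstar_mover[OF st[unfolded p] bal] unfolding p L_def by metis
  define a where "a = 1 / (2 * real K)"
  define D where "D = (real L + h) * \<tau>"
  have K0: "0 < real K" using K by simp
  have a: "X / (2 * real K) = a * X" "2 * real K * (a * X) = X" for X using K0 by (simp_all add: a_def)
  have D': "(real L + h) / tan \<theta>\<^sub>0 = D" "(real L + h) / (2 * real K * tan \<theta>\<^sub>0) = a * D"
    "(real L + 1 + h) / tan \<theta>\<^sub>0 = D + \<tau>" "(real (Suc L) + h) / (2 * real K * tan \<theta>\<^sub>0) = a * D + a * \<tau>"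
    using trig_pos K0 by (simp_all add: D_def \<tau> a_def field_simps)
  have x: "x = frac (a * X0)" and s: "s = frac (a * D)" and \<xi>: "\<xi> = row K B"
    using Psi unfolding B(1) Psi_mover[OF B(2,3)] D' a by simp_all
  show "x \<in> T1" "s \<in> T1" by (simp_all add: x s T1_def frac_lt_1)
  show "\<xi> \<in> Cstar K" unfolding \<xi> by (rule row_in_Cstar[OF B(2,3)])
  define U where "U = 2 * real K * frac (x + s)"
  define q where "q = \<lfloor>a * X0 + a * D\<rfloor>"
  have "frac (x + s) = frac (a * X0 + a * D)"
    unfolding x s by (rule frac_eqI) (simp add: frac_def)
  then have f: "frac (x + s) = a * X0 + a * D - of_int q"
    by (simp add: frac_def q_def)
  have "U = 2 * real K * (a * (X0 + D) - of_int q)"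
    unfolding U_def f by (simp add: distrib_left)
  also have "\<dots> = X0 + D + 2 * real K * of_int (- q)"
    using a(2)[of "X0 + D"] by (simp add: right_diff_distrib)
  finally have U: "U = X0 + 2 * real K * of_int (- q) + D" by simp
  define X where "X = X0 + 2 * real K * of_int (- q)"
  have eX: "(p, \<eta>, \<theta>) = mover X (- h) (layered K L B) True"
    unfolding B(1) X_def by (rule mover_period[symmetric])
  have aU: "a * U = frac (x + s)" using K0 by (simp add: a_def U_def)
  define c b where "c = \<lfloor>U\<rfloor>" and "b = \<lfloor>frac U + \<tau>\<rfloor> - \<lfloor>\<tau>\<rfloor>"
  have jB: "j = (B, c, b)"
    by (simp add: j piece_of_def \<xi> bricks_row[OF B(2)] Let_def U_def[symmetric] c_def b_def)
  define N where "N = K * (K - 1)"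
  define V where "V = of_int (snd (passage K B c)) - real N + frac U + \<tau>"
  have ret: "first_return K h \<theta>\<^sub>0 (p, \<eta>, \<theta>) = (if cell K c \<in> B
    then mover (U + D) (- h) (layered K L (B - {cell K c})) True
    else mover (V + (D + \<tau>)) (- h) (layered K (Suc L) ({..<K} - {cell K \<lfloor>V\<rfloor>})) True)"
    using first_return_from_floor[OF B(2,3) steep st[unfolded eX], of U]
    unfolding eX D' c_def V_def N_def \<tau> X_def U by simp
  have as: "frac (a * D + z) = frac (s + z)" for z unfolding s by (simp add: frac_add_left)
  show "Psi K h \<theta>\<^sub>0 (first_return K h \<theta>\<^sub>0 (p, \<eta>, \<theta>)) =
      (frac (x + 2 * s + twist K \<tau> j), frac (s + real (climb K j) * (\<tau> / (2 * real K))), row K (next_bricks K \<tau> j))"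
  proof (cases "cell K c \<in> B")
    case hit: True
    have 1: "frac (a * (U + D)) = frac (x + 2 * s)"
      unfolding distrib_left aU unfolding s by (rule frac_eqI) (simp add: frac_def)
    have tw: "twist K \<tau> j = 0" using hit by (simp add: twist_def jB)
    show ?thesis
    proof (cases "B = {cell K c}")
      case True
      have "first_return K h \<theta>\<^sub>0 (p, \<eta>, \<theta>) = mover (U + D) (- h) (layered K (Suc L) {..<K}) True"
        using ret hit True layered_empty[of K L] by (metis Diff_cancel)
      moreover have "{..<K} \<noteq> {}" using K by (auto simp: lessThan_empty_iff)
      moreover have "climb K j = 1" "next_bricks K \<tau> j = {..<K}"
        using hit True by (auto simp: climb_def next_bricks_def jB)
      ultimately show ?thesis
        using Psi_mover[of "{..<K}" "U + D" "- h" "Suc L"] unfolding D' a by (simp add: 1 tw as)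
    next
      case False
      then have "B - {cell K c} \<noteq> {}" "B - {cell K c} \<subseteq> {..<K}" using hit B(2) by auto
      moreover have "climb K j = 0" "next_bricks K \<tau> j = B - {cell K c}"
        using hit False by (auto simp: climb_def next_bricks_def jB)
      ultimately show ?thesis
        using Psi_mover[of "B - {cell K c}" "U + D" "- h" L] ret hit unfolding D' a
        by (simp add: 1 tw as[of 0, simplified])
    qed
  next
    case gap: False
    have "\<lfloor>V\<rfloor> = snd (passage K B c) - int N + \<lfloor>\<tau>\<rfloor> + b"
    proof -
      have "V = frac U + \<tau> + of_int (snd (passage K B c) - int N)" by (simp add: V_def)
      then have "\<lfloor>V\<rfloor> = \<lfloor>frac U + \<tau>\<rfloor> + (snd (passage K B c) - int N)" by (simp only: floor_add_int)
      then show ?thesis by (simp add: b_def)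
    qed
    then have nb: "next_bricks K \<tau> j = {..<K} - {cell K \<lfloor>V\<rfloor>}"
      using gap by (simp add: next_bricks_def landing_cell_def jB N_def)
    have jp: "j \<in> pieces K"
      unfolding j using piece_of_in_pieces[OF K \<open>\<xi> \<in> Cstar K\<close>] .
    have cl: "climb K j = 1" using gap by (simp add: climb_def jB)
    have tw: "twist K \<tau> j = frac (2 * (a * \<tau>) + a * (of_int (snd (passage K B c)) - of_int c - real N))"
      using gap by (simp add: twist_def jB a N_def del: of_nat_mult)
    have V': "V + (D + \<tau>) = U + (of_int (snd (passage K B c)) - of_int c - real N) + D + 2 * \<tau>"
      by (simp add: V_def frac_def c_def)
    have "a * (V + (D + \<tau>)) = frac (x + s) + a * (of_int (snd (passage K B c)) - of_int c - real N) + a * D + 2 * (a * \<tau>)"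
      unfolding V' by (simp only: distrib_left aU)
    then have 1: "frac (a * (V + (D + \<tau>))) = frac (x + 2 * s + twist K \<tau> j)"
      unfolding tw s by (intro frac_eqI) (simp add: frac_def)
    have nb2: "{..<K} - {cell K \<lfloor>V\<rfloor>} \<subseteq> {..<K}" "{..<K} - {cell K \<lfloor>V\<rfloor>} \<noteq> {}"
      using next_bricks_piece[OF K jp, of \<tau>] unfolding nb by blast+
    have "Psi K h \<theta>\<^sub>0 (first_return K h \<theta>\<^sub>0 (p, \<eta>, \<theta>)) =
      (frac (a * (V + (D + \<tau>))), frac (a * D + a * \<tau>), row K ({..<K} - {cell K \<lfloor>V\<rfloor>}))"
      using ret gap Psi_mover[OF nb2, of "V + (D + \<tau>)" "- h" "Suc L"] unfolding D' a by simp
    then show ?thesis unfolding 1 as nb cl by (simp add: a)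
  qed
qed

end

theorem proposition3p6:
  fixes K :: nat and \<theta>\<^sub>0 \<alpha> :: real
  assumes "1 \<le> K"
    and "0 < \<theta>\<^sub>0" and "\<theta>\<^sub>0 < theta_star K"
    and "\<alpha> = 1 / (2 * real K * tan \<theta>\<^sub>0)"
  shows "\<exists>(Q :: nat set) (I :: real \<Rightarrow> nat \<Rightarrow> (real \<times> (nat \<Rightarrow> nat)) set)
            (\<gamma> :: nat \<Rightarrow> real) (\<epsilon> :: nat \<Rightarrow> nat) (\<xi>' :: nat \<Rightarrow> nat \<Rightarrow> nat)
            (\<phi> :: real \<times> real \<times> (nat \<Rightarrow> nat) \<Rightarrow> real \<times> real \<times> (nat \<Rightarrow> nat)).
      finite Q \<and>
      (\<forall>s\<in>{0..<1}. interval_partition K Q (I s)) \<and>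
      (\<forall>i\<in>Q. \<gamma> i \<in> T1 \<and> \<epsilon> i \<in> {0, 1} \<and> \<xi>' i \<in> Cstar K) \<and>
      \<phi> \<in> T1 \<times> T1 \<times> Cstar K \<rightarrow> T1 \<times> T1 \<times> Cstar K \<and>
      (\<forall>i\<in>Q. \<forall>s\<in>{0..<1}. \<forall>(x, \<xi>)\<in>I s i.
         \<phi> (x, s, \<xi>) = (frac (x + 2 * s + \<gamma> i), frac (s + real (\<epsilon> i) * \<alpha>), \<xi>' i)) \<and>
      (\<forall>h\<ge>0. \<forall>(x, \<eta>, \<theta>)\<in>Bstar K h \<theta>\<^sub>0. balanced K \<eta> \<longrightarrow>
         \<phi> (Psi K h \<theta>\<^sub>0 (x, \<eta>, \<theta>)) = Psi K h \<theta>\<^sub>0 (first_return K h \<theta>\<^sub>0 (x, \<eta>, \<theta>)))"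
proof -
  define \<tau> where "\<tau> = 1 / tan \<theta>\<^sub>0"
  have \<alpha>: "\<alpha> = \<tau> / (2 * real K)" using assms(4) by (simp add: \<tau>_def)
  have pi2: "\<theta>\<^sub>0 < pi / 2"
    using assms(3) arctan_ubound[of "1 / (real K * (real K - 1))"] by (auto simp: theta_star_def split: if_splits)
  have steep: "real (K * (K - 1)) * tan \<theta>\<^sub>0 < 1"
  proof (cases "K = 1")
    case False
    then have pos: "0 < real K * (real K - 1)" using assms(1) by simp
    have "tan \<theta>\<^sub>0 < tan (arctan (1 / (real K * (real K - 1))))"
    proof (rule tan_monotone)
      show "- (pi / 2) < \<theta>\<^sub>0" using assms(2) pi_gt_zero by linarith
      show "\<theta>\<^sub>0 < arctan (1 / (real K * (real K - 1)))" using assms(3) False by (simp add: theta_star_def)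
      show "arctan (1 / (real K * (real K - 1))) < pi / 2" by (rule arctan_ubound)
    qed
    then have "tan \<theta>\<^sub>0 < 1 / (real K * (real K - 1))" by (simp add: tan_arctan)
    then have "real K * (real K - 1) * tan \<theta>\<^sub>0 < 1" using pos by (simp add: pos_less_divide_eq mult.commute)
    then show ?thesis using assms(1) by (simp add: of_nat_diff)
  qed simp
  obtain e :: "nat set \<times> int \<times> int \<Rightarrow> nat" where e: "inj_on e (pieces K)"
    using finite_imp_inj_to_nat_seg[OF finite_pieces] by blast
  define d where "d = inv_into (pieces K) e"
  have de: "d (e j) = j" if "j \<in> pieces K" for j using that e by (simp add: d_def)
  define I where "I s i = {p \<in> T1 \<times> Cstar K. piece_of K \<tau> s p = d i}" for s i
  define \<phi> where "\<phi> = (\<lambda>(x, s, \<xi>). let j = piece_of K \<tau> s (x, \<xi>) in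
     (frac (x + 2 * s + twist K \<tau> j), frac (s + real (climb K j) * \<alpha>), row K (next_bricks K \<tau> j)))"
  have next_row: "row K (next_bricks K \<tau> j) \<in> Cstar K" if "j \<in> pieces K" for j
    using next_bricks_piece[OF assms(1) that] row_in_Cstar by blast
  have T1: "frac t \<in> T1" for t by (simp add: T1_def frac_lt_1)
  show ?thesis
  proof (intro exI conjI ballI allI impI)
    show "finite (e ` pieces K)" using finite_pieces by simp
  next
    fix s :: real
    note part = interval_partition_pieces[OF assms(1), of \<tau> s]
    have I: "I s (e j) = {p \<in> T1 \<times> Cstar K. piece_of K \<tau> s p = j}" if "j \<in> pieces K" for j
      using de[OF that] by (simp add: I_def)
    show "interval_partition K (e ` pieces K) (I s)"
      using part e unfolding interval_partition_def disjoint_family_on_def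
      by (auto simp: I inj_on_eq_iff)
  next
    fix i assume "i \<in> e ` pieces K"
    then have di: "d i \<in> pieces K" using de by auto
    obtain B c b where B: "d i = (B, c, b)" by (cases "d i")
    show "twist K \<tau> (d i) \<in> T1" using T1 by (simp add: twist_def B) (simp add: T1_def)
    show "climb K (d i) \<in> {0, 1}" by (simp add: climb_def B)
    show "row K (next_bricks K \<tau> (d i)) \<in> Cstar K" by (rule next_row[OF di])
  next
    show "\<phi> \<in> T1 \<times> T1 \<times> Cstar K \<rightarrow> T1 \<times> T1 \<times> Cstar K"
      using T1 next_row[OF piece_of_in_pieces[OF assms(1)]] by (auto simp: \<phi>_def Let_def)
  next
    fix i s p assume p: "p \<in> I s i"
    then show "case p of (x, \<xi>) \<Rightarrow> \<phi> (x, s, \<xi>) =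
        (frac (x + 2 * s + twist K \<tau> (d i)), frac (s + real (climb K (d i)) * \<alpha>), row K (next_bricks K \<tau> (d i)))"
      by (auto simp: I_def \<phi>_def Let_def)
  next
    fix h :: real and st assume h: "0 \<le> h" and st: "st \<in> Bstar K h \<theta>\<^sub>0"
    interpret brick_billiard K h \<theta>\<^sub>0 using assms h pi2 by unfold_locales auto
    obtain p \<eta> \<theta> where eq: "st = (p, \<eta>, \<theta>)" by (cases st)
    obtain x s \<xi> where Psi: "Psi K h \<theta>\<^sub>0 (p, \<eta>, \<theta>) = (x, s, \<xi>)" by (metis prod_cases3)
    have "\<phi> (Psi K h \<theta>\<^sub>0 (p, \<eta>, \<theta>)) = Psi K h \<theta>\<^sub>0 (first_return K h \<theta>\<^sub>0 (p, \<eta>, \<theta>))" if "balanced K \<eta>"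
      using Psi_first_return(1)[OF _ that steep \<tau>_def Psi refl] st
      unfolding eq Psi by (simp add: \<phi>_def Let_def \<alpha>)
    then show "case st of (x, \<eta>, \<theta>) \<Rightarrow> balanced K \<eta> \<longrightarrow>
        \<phi> (Psi K h \<theta>\<^sub>0 (x, \<eta>, \<theta>)) = Psi K h \<theta>\<^sub>0 (first_return K h \<theta>\<^sub>0 (x, \<eta>, \<theta>))"
      by (simp add: eq)
  qed
qed

end
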